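(* Let $T^8=\mathbb{R}^8/\mathbb{Z}^8$ be the 8-dimensional real torus obtained as the quotient of $\mathbb{R}^8$ by the standard lattice, let $$A=\left(\begin{array}{rrrrrrrr}1&0&1&0&-1&-1&0&1\\0&-1&0&-1&-1&0&1&1\\-1&0&1&0&0&1&1&1\\0&1&0&-1&1&1&1&0\\1&1&0&-1&1&0&1&0\\1&0&-1&-1&0&-1&0&-1\\0&-1&-1&-1&-1&0&1&0\\-1&-1&-1&0&0&1&0&-1\end{array}\right)\in SL(8,\mathbb{Z}),$$ let $f_A$ be the diffeomorphism of $T^8$ defined by $A$, and let $S=S(T^8,f_A,\mathrm{id},\mathrm{id},\mathrm{id})$ be the corresponding toric suspension. Then $S$ admits a pseudo-hyperkähler structure $(I,J,K,h)$. In particular, for the complex structure $I$, $S$ carries both hypercomplex and holomorphic symplectic structures, but no Kähler metrics. Moreover, the Obata connection of the hypercomplex structure is flat.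
   Context: Structures on $T^8$: in terms of the standard basis $(e_1,\ldots,e_8)$ of $\mathbb{R}^8$, consider the hypercomplex structure $(I,J,K=IJ)$ with $Ie_1=e_3,\ Ie_2=e_4,\ Ie_5=-e_7,\ Ie_6=-e_8$ and $Je_1=-e_5,\ Je_2=-e_6,\ Je_3=-e_7,\ Je_4=-e_8$ (extended by $I^2=J^2=-1$), and the pseudo-hyperhermitian metric $h=(e^1)^2-(e^2)^2+(e^3)^2-(e^4)^2+(e^5)^2-(e^6)^2+(e^7)^2-(e^8)^2$. The matrix $A$ preserves $(I,J,K,h)$ and the lattice $\mathbb{Z}^8$, so these structures descend to $T^8$ and are preserved by $f_A$. Suspension: $S(T^8,f_A,\mathrm{id},\mathrm{id},\mathrm{id})$ is the quotient of $T^8\times\mathbb{R}^4$ by the action of $\mathbb{Z}^4$ whose first generator acts by $(p,x_1,x_2,x_3,x_4)\mapsto(f_A(p),x_1+1,x_2,x_3,x_4)$ and whose other three generators act trivially on $T^8$ and as unit translations in $x_2,x_3,x_4$ respectively. The structure $(I,J,K,h)$ on $S$ is the one induced by the product of the structure above on $T^8$ with the canonical flat hyperkähler structure on $\mathbb{R}^4=\mathbb{H}$. A hypercomplex structure is a triple of integrable complex structures $I,J,K$ with $IJ=-JI=K$. A pseudo-hyperhermitian metric is an indefinite (pseudo-Riemannian) metric for which $I,J,K$ are all orthogonal; it is called pseudo-hyperkähler if the three fundamental forms $\omega_I,\omega_J,\omega_K$ are closed. The Obata connection of a hypercomplex manifold is the unique torsion-free connection preserving $I,J,K$. *)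

theory Defs
  imports "HOL-Analysis.Analysis"
begin

section \<open>Smooth manifolds\<close>

primrec Ck_on :: "nat \<Rightarrow> 'a::euclidean_space set \<Rightarrow> ('a \<Rightarrow> 'b::real_normed_vector) \<Rightarrow> bool" where
  "Ck_on 0 U f \<longleftrightarrow> continuous_on U f"
| "Ck_on (Suc k) U f \<longleftrightarrow>
     (\<forall>x\<in>U. f differentiable (at x)) \<and> (\<forall>v. Ck_on k U (\<lambda>x. frechet_derivative f (at x) v))"

text \<open>Meant for open \<open>U\<close> only.\<close>
definition smooth_on :: "'a::euclidean_space set \<Rightarrow> ('a \<Rightarrow> 'b::real_normed_vector) \<Rightarrow> bool" where
  "smooth_on U f \<longleftrightarrow> (\<forall>k. Ck_on k U f)"

text \<open>A chart is a coordinate domain together with its coordinate map; the values of the map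
  outside the domain are irrelevant.\<close>
type_synonym ('m, 'b) chart = "'m set \<times> ('m \<Rightarrow> 'b)"

definition chart_image :: "('m, 'b) chart \<Rightarrow> 'b set" where
  "chart_image c = snd c ` fst c"

text \<open>The coordinate change from \<open>c\<close> to \<open>d\<close>, to be used on \<open>overlap c d\<close>.\<close>
definition overlap :: "('m, 'b) chart \<Rightarrow> ('m, 'b) chart \<Rightarrow> 'b set" where
  "overlap c d = snd c ` (fst c \<inter> fst d)"

definition transition :: "('m, 'b) chart \<Rightarrow> ('m, 'b) chart \<Rightarrow> 'b \<Rightarrow> 'b" where
  "transition c d = snd d \<circ> inv_into (fst c) (snd c)"

definition smooth_manifold :: "'m topology \<Rightarrow> ('m, 'b::euclidean_space) chart set \<Rightarrow> bool" where
  "smooth_manifold X A \<longleftrightarrow>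
     Hausdorff_space X \<and> second_countable X \<and> (\<Union>c\<in>A. fst c) = topspace X \<and>
     (\<forall>c\<in>A. openin X (fst c) \<and> open (chart_image c) \<and>
        homeomorphic_map (subtopology X (fst c)) (top_of_set (chart_image c)) (snd c)) \<and>
     (\<forall>c\<in>A. \<forall>d\<in>A. smooth_on (overlap c d) (transition c d))"

section \<open>Tensor fields and connections\<close>

text \<open>A tensor field or connection is a family of local representatives, one for each chart of the
  atlas, defined on the image of the chart and related by the appropriate transformation law.
  The values off the chart images, or at pairs that are not charts of the atlas, are irrelevant.\<close>
type_synonym ('m, 'b, 't) field = "('m, 'b) chart \<Rightarrow> 'b \<Rightarrow> 't"

definition endomorphism_field ::
  "('m, 'b::euclidean_space) chart set \<Rightarrow> ('m, 'b, 'b \<Rightarrow> 'b) field \<Rightarrow> bool" where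
  "endomorphism_field A I \<longleftrightarrow>
     (\<forall>c\<in>A. (\<forall>x\<in>chart_image c. linear (I c x)) \<and> (\<forall>v. smooth_on (chart_image c) (\<lambda>x. I c x v))) \<and>
     (\<forall>c\<in>A. \<forall>d\<in>A. \<forall>x\<in>overlap c d. \<forall>v.
        let D = frechet_derivative (transition c d) (at x)
        in I d (transition c d x) (D v) = D (I c x v))"

text \<open>Covariant 2-tensors; the values are real for metrics and complex for complex 2-forms.\<close>
definition bilinear_field ::
  "('m, 'b::euclidean_space) chart set \<Rightarrow> ('m, 'b, 'b \<Rightarrow> 'b \<Rightarrow> 'f::real_normed_vector) field \<Rightarrow> bool" where
  "bilinear_field A h \<longleftrightarrow>
     (\<forall>c\<in>A. (\<forall>x\<in>chart_image c. bilinear (h c x)) \<and>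
             (\<forall>u v. smooth_on (chart_image c) (\<lambda>x. h c x u v))) \<and>
     (\<forall>c\<in>A. \<forall>d\<in>A. \<forall>x\<in>overlap c d. \<forall>u v.
        let D = frechet_derivative (transition c d) (at x)
        in h d (transition c d x) (D u) (D v) = h c x u v)"

definition two_form ::
  "('m, 'b::euclidean_space) chart set \<Rightarrow> ('m, 'b, 'b \<Rightarrow> 'b \<Rightarrow> 'f::real_normed_vector) field \<Rightarrow> bool" where
  "two_form A \<omega> \<longleftrightarrow> bilinear_field A \<omega> \<and>
     (\<forall>c\<in>A. \<forall>x\<in>chart_image c. \<forall>u v. \<omega> c x v u = - \<omega> c x u v)"

definition exterior_derivative ::
  "('m, 'b, 'b \<Rightarrow> 'b \<Rightarrow> 'f) field \<Rightarrow>
   ('m, 'b::euclidean_space, 'b \<Rightarrow> 'b \<Rightarrow> 'b \<Rightarrow> 'f::real_normed_vector) field" where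
  "exterior_derivative \<omega> c x u v w =
     frechet_derivative (\<lambda>y. \<omega> c y v w) (at x) u +
     frechet_derivative (\<lambda>y. \<omega> c y w u) (at x) v +
     frechet_derivative (\<lambda>y. \<omega> c y u v) (at x) w"

definition closed_two_form ::
  "('m, 'b::euclidean_space) chart set \<Rightarrow> ('m, 'b, 'b \<Rightarrow> 'b \<Rightarrow> 'f::real_normed_vector) field \<Rightarrow> bool" where
  "closed_two_form A \<omega> \<longleftrightarrow> two_form A \<omega> \<and>
     (\<forall>c\<in>A. \<forall>x\<in>chart_image c. \<forall>u v w. exterior_derivative \<omega> c x u v w = 0)"

text \<open>An affine connection is given by its Christoffel maps
  \<open>\<Gamma> c x u v\<close>: in the chart \<open>c\<close>, \<open>\<nabla>\<^sub>u V = dV(u) + \<Gamma>(u, V)\<close>.\<close>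
definition connection ::
  "('m, 'b::euclidean_space) chart set \<Rightarrow> ('m, 'b, 'b \<Rightarrow> 'b \<Rightarrow> 'b) field \<Rightarrow> bool" where
  "connection A \<Gamma> \<longleftrightarrow>
     (\<forall>c\<in>A. (\<forall>x\<in>chart_image c. bilinear (\<Gamma> c x)) \<and>
             (\<forall>u v. smooth_on (chart_image c) (\<lambda>x. \<Gamma> c x u v))) \<and>
     (\<forall>c\<in>A. \<forall>d\<in>A. \<forall>x\<in>overlap c d. \<forall>u v.
        let D = (\<lambda>y. frechet_derivative (transition c d) (at y))
        in \<Gamma> d (transition c d x) (D x u) (D x v) =
           D x (\<Gamma> c x u v) - frechet_derivative (\<lambda>y. D y v) (at x) u)"

definition torsion_free ::
  "('m, 'b::euclidean_space) chart set \<Rightarrow> ('m, 'b, 'b \<Rightarrow> 'b \<Rightarrow> 'b) field \<Rightarrow> bool" where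
  "torsion_free A \<Gamma> \<longleftrightarrow> (\<forall>c\<in>A. \<forall>x\<in>chart_image c. \<forall>u v. \<Gamma> c x u v = \<Gamma> c x v u)"

text \<open>\<open>\<nabla>I = 0\<close>, where \<open>(\<nabla>\<^sub>u I) v = dI(u) v + \<Gamma>(u, I v) - I \<Gamma>(u, v)\<close>.\<close>
definition preserves ::
  "('m, 'b::euclidean_space) chart set \<Rightarrow> ('m, 'b, 'b \<Rightarrow> 'b \<Rightarrow> 'b) field \<Rightarrow>
   ('m, 'b, 'b \<Rightarrow> 'b) field \<Rightarrow> bool" where
  "preserves A \<Gamma> I \<longleftrightarrow> (\<forall>c\<in>A. \<forall>x\<in>chart_image c. \<forall>u v.
     frechet_derivative (\<lambda>y. I c y v) (at x) u + \<Gamma> c x u (I c x v) - I c x (\<Gamma> c x u v) = 0)"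

text \<open>\<open>curvature \<Gamma> c x u v w\<close> is \<open>R(u, v) w\<close>.\<close>
definition curvature ::
  "('m, 'b, 'b \<Rightarrow> 'b \<Rightarrow> 'b) field \<Rightarrow>
   ('m, 'b::euclidean_space, 'b \<Rightarrow> 'b \<Rightarrow> 'b \<Rightarrow> 'b) field" where
  "curvature \<Gamma> c x u v w =
     frechet_derivative (\<lambda>y. \<Gamma> c y v w) (at x) u - frechet_derivative (\<lambda>y. \<Gamma> c y u w) (at x) v
     + \<Gamma> c x u (\<Gamma> c x v w) - \<Gamma> c x v (\<Gamma> c x u w)"

definition flat ::
  "('m, 'b::euclidean_space) chart set \<Rightarrow> ('m, 'b, 'b \<Rightarrow> 'b \<Rightarrow> 'b) field \<Rightarrow> bool" where
  "flat A \<Gamma> \<longleftrightarrow> (\<forall>c\<in>A. \<forall>x\<in>chart_image c. \<forall>u v w. curvature \<Gamma> c x u v w = 0)"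

section \<open>Complex, hypercomplex and metric structures\<close>

text \<open>Integrability means existence of holomorphic coordinates: around each point there is a
  smooth coordinate system \<open>\<psi>\<close> in which the structure is a constant linear complex structure
  \<open>J0\<close>.\<close>
definition integrable_structure ::
  "('m, 'b::euclidean_space) chart set \<Rightarrow> ('m, 'b, 'b \<Rightarrow> 'b) field \<Rightarrow> bool" where
  "integrable_structure A I \<longleftrightarrow> (\<forall>c\<in>A. \<forall>x\<in>chart_image c. \<exists>W (\<psi> :: 'b \<Rightarrow> 'b) J0.
     open W \<and> x \<in> W \<and> W \<subseteq> chart_image c \<and>
     inj_on \<psi> W \<and> open (\<psi> ` W) \<and> smooth_on W \<psi> \<and> smooth_on (\<psi> ` W) (inv_into W \<psi>) \<and>
     linear J0 \<and> (\<forall>v. J0 (J0 v) = - v) \<and>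
     (\<forall>y\<in>W. \<forall>v. frechet_derivative \<psi> (at y) (I c y v) = J0 (frechet_derivative \<psi> (at y) v)))"

definition complex_structure ::
  "('m, 'b::euclidean_space) chart set \<Rightarrow> ('m, 'b, 'b \<Rightarrow> 'b) field \<Rightarrow> bool" where
  "complex_structure A I \<longleftrightarrow> endomorphism_field A I \<and>
     (\<forall>c\<in>A. \<forall>x\<in>chart_image c. \<forall>v. I c x (I c x v) = - v) \<and> integrable_structure A I"

definition hypercomplex_structure ::
  "('m, 'b::euclidean_space) chart set \<Rightarrow> ('m, 'b, 'b \<Rightarrow> 'b) field \<Rightarrow> ('m, 'b, 'b \<Rightarrow> 'b) field \<Rightarrow>
   ('m, 'b, 'b \<Rightarrow> 'b) field \<Rightarrow> bool" where
  "hypercomplex_structure A I J K \<longleftrightarrow>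
     complex_structure A I \<and> complex_structure A J \<and> complex_structure A K \<and>
     (\<forall>c\<in>A. \<forall>x\<in>chart_image c. \<forall>v. I c x (J c x v) = K c x v \<and> J c x (I c x v) = - K c x v)"

definition orthogonal_for ::
  "('m, 'b::euclidean_space) chart set \<Rightarrow> ('m, 'b, 'b \<Rightarrow> 'b \<Rightarrow> real) field \<Rightarrow>
   ('m, 'b, 'b \<Rightarrow> 'b) field \<Rightarrow> bool" where
  "orthogonal_for A h I \<longleftrightarrow> (\<forall>c\<in>A. \<forall>x\<in>chart_image c. \<forall>u v. h c x (I c x u) (I c x v) = h c x u v)"

definition fundamental_form ::
  "('m, 'b, 'b \<Rightarrow> 'b \<Rightarrow> real) field \<Rightarrow> ('m, 'b, 'b \<Rightarrow> 'b) field \<Rightarrow> ('m, 'b, 'b \<Rightarrow> 'b \<Rightarrow> real) field" where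
  "fundamental_form h I c x u v = h c x (I c x u) v"

definition indefinite_metric ::
  "('m, 'b::euclidean_space) chart set \<Rightarrow> ('m, 'b, 'b \<Rightarrow> 'b \<Rightarrow> real) field \<Rightarrow> bool" where
  "indefinite_metric A h \<longleftrightarrow> bilinear_field A h \<and> (\<forall>c\<in>A. \<forall>x\<in>chart_image c.
     (\<forall>u v. h c x u v = h c x v u) \<and>
     (\<forall>u. u \<noteq> 0 \<longrightarrow> (\<exists>v. h c x u v \<noteq> 0)) \<and>
     (\<exists>u. h c x u u > 0) \<and> (\<exists>u. h c x u u < 0))"

definition riemannian_metric ::
  "('m, 'b::euclidean_space) chart set \<Rightarrow> ('m, 'b, 'b \<Rightarrow> 'b \<Rightarrow> real) field \<Rightarrow> bool" where
  "riemannian_metric A g \<longleftrightarrow> bilinear_field A g \<and> (\<forall>c\<in>A. \<forall>x\<in>chart_image c.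
     (\<forall>u v. g c x u v = g c x v u) \<and> (\<forall>u. u \<noteq> 0 \<longrightarrow> g c x u u > 0))"

definition pseudo_hyperhermitian ::
  "('m, 'b::euclidean_space) chart set \<Rightarrow> ('m, 'b, 'b \<Rightarrow> 'b) field \<Rightarrow> ('m, 'b, 'b \<Rightarrow> 'b) field \<Rightarrow>
   ('m, 'b, 'b \<Rightarrow> 'b) field \<Rightarrow> ('m, 'b, 'b \<Rightarrow> 'b \<Rightarrow> real) field \<Rightarrow> bool" where
  "pseudo_hyperhermitian A I J K h \<longleftrightarrow> hypercomplex_structure A I J K \<and> indefinite_metric A h \<and>
     orthogonal_for A h I \<and> orthogonal_for A h J \<and> orthogonal_for A h K"

definition pseudo_hyperkaehler ::
  "('m, 'b::euclidean_space) chart set \<Rightarrow> ('m, 'b, 'b \<Rightarrow> 'b) field \<Rightarrow> ('m, 'b, 'b \<Rightarrow> 'b) field \<Rightarrow>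
   ('m, 'b, 'b \<Rightarrow> 'b) field \<Rightarrow> ('m, 'b, 'b \<Rightarrow> 'b \<Rightarrow> real) field \<Rightarrow> bool" where
  "pseudo_hyperkaehler A I J K h \<longleftrightarrow> pseudo_hyperhermitian A I J K h \<and>
     closed_two_form A (fundamental_form h I) \<and>
     closed_two_form A (fundamental_form h J) \<and>
     closed_two_form A (fundamental_form h K)"

definition kaehler_metric ::
  "('m, 'b::euclidean_space) chart set \<Rightarrow> ('m, 'b, 'b \<Rightarrow> 'b) field \<Rightarrow>
   ('m, 'b, 'b \<Rightarrow> 'b \<Rightarrow> real) field \<Rightarrow> bool" where
  "kaehler_metric A I g \<longleftrightarrow> complex_structure A I \<and> riemannian_metric A g \<and> orthogonal_for A g I \<and>
     closed_two_form A (fundamental_form g I)"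

text \<open>A closed nondegenerate 2-form of type \<open>(2,0)\<close>, the type being expressed by
  \<open>\<Omega>(I u, v) = \<i> \<Omega>(u, v)\<close>. Such a form is holomorphic, since its \<open>\<partial>\<close>-bar-derivative
  is the \<open>(2,1)\<close>-part of \<open>d\<Omega>\<close>.\<close>
definition holomorphic_symplectic ::
  "('m, 'b::euclidean_space) chart set \<Rightarrow> ('m, 'b, 'b \<Rightarrow> 'b) field \<Rightarrow>
   ('m, 'b, 'b \<Rightarrow> 'b \<Rightarrow> complex) field \<Rightarrow> bool" where
  "holomorphic_symplectic A I \<Omega> \<longleftrightarrow> complex_structure A I \<and> closed_two_form A \<Omega> \<and>
     (\<forall>c\<in>A. \<forall>x\<in>chart_image c.
        (\<forall>u v. \<Omega> c x (I c x u) v = \<i> * \<Omega> c x u v) \<and>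
        (\<forall>u. u \<noteq> 0 \<longrightarrow> (\<exists>v. \<Omega> c x u v \<noteq> 0)))"

definition obata_connection ::
  "('m, 'b::euclidean_space) chart set \<Rightarrow> ('m, 'b, 'b \<Rightarrow> 'b) field \<Rightarrow> ('m, 'b, 'b \<Rightarrow> 'b) field \<Rightarrow>
   ('m, 'b, 'b \<Rightarrow> 'b) field \<Rightarrow> ('m, 'b, 'b \<Rightarrow> 'b \<Rightarrow> 'b) field \<Rightarrow> bool" where
  "obata_connection A I J K \<Gamma> \<longleftrightarrow> connection A \<Gamma> \<and> torsion_free A \<Gamma> \<and>
     preserves A \<Gamma> I \<and> preserves A \<Gamma> J \<and> preserves A \<Gamma> K"

section \<open>Quotients and suspensions\<close>

definition quotient_topology :: "'a topology \<Rightarrow> ('a \<Rightarrow> 'b) \<Rightarrow> 'b topology" where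
  "quotient_topology X f =
     topology (\<lambda>V. V \<subseteq> f ` topspace X \<and> openin X {x \<in> topspace X. f x \<in> V})"

lemma openin_quotient_topology:
  "openin (quotient_topology X f) V \<longleftrightarrow> V \<subseteq> f ` topspace X \<and> openin X {x \<in> topspace X. f x \<in> V}"
proof -
  have "istopology (\<lambda>V. V \<subseteq> f ` topspace X \<and> openin X {x \<in> topspace X. f x \<in> V})"
    unfolding istopology_def
  proof (intro conjI allI impI)
    fix S T
    assume S: "S \<subseteq> f ` topspace X \<and> openin X {x \<in> topspace X. f x \<in> S}"
      and T: "T \<subseteq> f ` topspace X \<and> openin X {x \<in> topspace X. f x \<in> T}"
    show "S \<inter> T \<subseteq> f ` topspace X" using S by blast
    have "{x \<in> topspace X. f x \<in> S \<inter> T} = {x \<in> topspace X. f x \<in> S} \<inter> {x \<in> topspace X. f x \<in> T}"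
      by blast
    then show "openin X {x \<in> topspace X. f x \<in> S \<inter> T}"
      using S T by (simp only: openin_Int)
  next
    fix \<K>
    assume K: "\<forall>V\<in>\<K>. V \<subseteq> f ` topspace X \<and> openin X {x \<in> topspace X. f x \<in> V}"
    then show "\<Union>\<K> \<subseteq> f ` topspace X" by blast
    have eq: "{x \<in> topspace X. f x \<in> \<Union>\<K>} = \<Union>((\<lambda>V. {x \<in> topspace X. f x \<in> V}) ` \<K>)"
      by blast
    show "openin X {x \<in> topspace X. f x \<in> \<Union>\<K>}"
      unfolding eq by (rule openin_Union) (use K in blast)
  qed
  then show ?thesis
    unfolding quotient_topology_def by (simp only: topology_inverse')
qed

lemma topspace_quotient_topology: "topspace (quotient_topology X f) = f ` topspace X"
proof -
  have "{x \<in> topspace X. f x \<in> f ` topspace X} = topspace X" by blast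
  then have "openin (quotient_topology X f) (f ` topspace X)"
    by (simp add: openin_quotient_topology)
  then have "f ` topspace X \<subseteq> topspace (quotient_topology X f)"
    by (rule openin_subset)
  moreover have "topspace (quotient_topology X f) \<subseteq> f ` topspace X"
    using openin_topspace[of "quotient_topology X f"] unfolding openin_quotient_topology by blast
  ultimately show ?thesis by blast
qed

lemma quotient_map_quotient_topology: "quotient_map X (quotient_topology X f) f"
  unfolding quotient_map_def topspace_quotient_topology openin_quotient_topology by blast

text \<open>The smooth structure making \<open>p\<close> a local diffeomorphism, where \<open>p\<close> is a covering map of
  the manifold by Euclidean space: the coordinate maps are the local inverses of \<open>p\<close>. The image of
  the chart belonging to \<open>U\<close> is \<open>U\<close> itself.\<close>
definition quotient_atlas :: "('b::euclidean_space \<Rightarrow> 'm) \<Rightarrow> ('m, 'b) chart set" where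
  "quotient_atlas p = {(p ` U, inv_into U p) | U. open U \<and> inj_on p U}"

text \<open>For commuting self-homeomorphisms \<open>f i\<close> of \<open>X\<close>, \<open>i\<close> ranging over the \<open>n\<close>-element index type,
  the suspension is the quotient of \<open>X \<times> \<real>\<^sup>n\<close> by the \<open>\<int>\<^sup>n\<close>-action whose \<open>i\<close>-th generator is
  \<open>(p, x) \<mapsto> (f i p, x + e\<^sub>i)\<close>. The orbit relation is the equivalence relation generated by these
  steps, and a point of the suspension is an orbit.\<close>
definition suspension_step ::
  "'p topology \<Rightarrow> ('n::finite \<Rightarrow> 'p \<Rightarrow> 'p) \<Rightarrow> (('p \<times> (real^'n)) \<times> ('p \<times> (real^'n))) set" where
  "suspension_step X f = {((p, x), (f i p, x + axis i 1)) | p x i. p \<in> topspace X}"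

definition suspension_proj ::
  "'p topology \<Rightarrow> ('n::finite \<Rightarrow> 'p \<Rightarrow> 'p) \<Rightarrow> 'p \<times> (real^'n) \<Rightarrow> ('p \<times> (real^'n)) set" where
  "suspension_proj X f q = (suspension_step X f \<union> (suspension_step X f)\<inverse>)\<^sup>* `` {q}"

definition suspension ::
  "'p topology \<Rightarrow> ('n::finite \<Rightarrow> 'p \<Rightarrow> 'p) \<Rightarrow> ('p \<times> (real^'n)) set topology" where
  "suspension X f = quotient_topology (prod_topology X euclidean) (suspension_proj X f)"

section \<open>The torus, its automorphism and the suspension\<close>

definition torus_class :: "real^8 \<Rightarrow> (real^8) set" where
  "torus_class x = {y. \<forall>i. y $ i - x $ i \<in> \<int>}"

definition torus8 :: "(real^8) set topology" where
  "torus8 = quotient_topology euclidean torus_class"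

definition matA :: "int^8^8" where
  "matA = vector [
     vector [ 1,  0,  1,  0, -1, -1,  0,  1],
     vector [ 0, -1,  0, -1, -1,  0,  1,  1],
     vector [-1,  0,  1,  0,  0,  1,  1,  1],
     vector [ 0,  1,  0, -1,  1,  1,  1,  0],
     vector [ 1,  1,  0, -1,  1,  0,  1,  0],
     vector [ 1,  0, -1, -1,  0, -1,  0, -1],
     vector [ 0, -1, -1, -1, -1,  0,  1,  0],
     vector [-1, -1, -1,  0,  0,  1,  0, -1]]"

text \<open>As \<open>matA\<close> is unimodular, the image of the coset of \<open>x\<close> is the coset of \<open>matA x\<close>.\<close>
definition f_A :: "(real^8) set \<Rightarrow> (real^8) set" where
  "f_A P = (\<lambda>x. (\<chi> i j. real_of_int (matA $ i $ j)) *v x) ` P"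

definition susp_maps :: "4 \<Rightarrow> (real^8) set \<Rightarrow> (real^8) set" where
  "susp_maps i = (if i = 1 then f_A else id)"

type_synonym S_point = "((real^8) set \<times> (real^4)) set"

type_synonym E12 = "(real^8) \<times> (real^4)"

definition S_A :: "S_point topology" where
  "S_A = suspension torus8 susp_maps"

definition cover_S :: "E12 \<Rightarrow> S_point" where
  "cover_S = (\<lambda>(v, x). suspension_proj torus8 susp_maps (torus_class v, x))"

definition atlas_S :: "(S_point, E12) chart set" where
  "atlas_S = quotient_atlas cover_S"

section \<open>The structures\<close>

definition I8 :: "real^8 \<Rightarrow> real^8" where
  "I8 v = v$1 *\<^sub>R axis 3 1 + v$2 *\<^sub>R axis 4 1 - v$3 *\<^sub>R axis 1 1 - v$4 *\<^sub>R axis 2 1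
        - v$5 *\<^sub>R axis 7 1 - v$6 *\<^sub>R axis 8 1 + v$7 *\<^sub>R axis 5 1 + v$8 *\<^sub>R axis 6 1"

definition J8 :: "real^8 \<Rightarrow> real^8" where
  "J8 v = - v$1 *\<^sub>R axis 5 1 - v$2 *\<^sub>R axis 6 1 - v$3 *\<^sub>R axis 7 1 - v$4 *\<^sub>R axis 8 1
        + v$5 *\<^sub>R axis 1 1 + v$6 *\<^sub>R axis 2 1 + v$7 *\<^sub>R axis 3 1 + v$8 *\<^sub>R axis 4 1"

definition h8 :: "real^8 \<Rightarrow> real^8 \<Rightarrow> real" where
  "h8 u v = u$1 * v$1 - u$2 * v$2 + u$3 * v$3 - u$4 * v$4
          + u$5 * v$5 - u$6 * v$6 + u$7 * v$7 - u$8 * v$8"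

text \<open>The flat hyperkaehler structure on \<open>\<real>\<^sup>4 = \<H>\<close>, \<open>x\<close> standing for \<open>x\<^sub>1 + x\<^sub>2 i + x\<^sub>3 j + x\<^sub>4 k\<close>:
  \<open>I4\<close> and \<open>J4\<close> are the left multiplications by \<open>i\<close> and \<open>j\<close>; the metric is the Euclidean one.\<close>
definition I4 :: "real^4 \<Rightarrow> real^4" where
  "I4 x = x$1 *\<^sub>R axis 2 1 - x$2 *\<^sub>R axis 1 1 + x$3 *\<^sub>R axis 4 1 - x$4 *\<^sub>R axis 3 1"

definition J4 :: "real^4 \<Rightarrow> real^4" where
  "J4 x = x$1 *\<^sub>R axis 3 1 - x$3 *\<^sub>R axis 1 1 - x$2 *\<^sub>R axis 4 1 + x$4 *\<^sub>R axis 2 1"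

text \<open>The structures that the product structures on \<open>\<real>\<^sup>8 \<times> \<real>\<^sup>4\<close> induce on the quotient:
  since the charts of \<open>atlas_S\<close> are local inverses of \<open>cover_S\<close>, the representative in a chart is
  the restriction of the (constant) field upstairs. That these representatives agree on overlaps
  is part of what the predicates above assert.\<close>
definition I_S :: "(S_point, E12, E12 \<Rightarrow> E12) field" where
  "I_S c y = (\<lambda>(v, x). (I8 v, I4 x))"

definition J_S :: "(S_point, E12, E12 \<Rightarrow> E12) field" where
  "J_S c y = (\<lambda>(v, x). (J8 v, J4 x))"

definition K_S :: "(S_point, E12, E12 \<Rightarrow> E12) field" where
  "K_S c y = I_S c y \<circ> J_S c y"

definition h_S :: "(S_point, E12, E12 \<Rightarrow> E12 \<Rightarrow> real) field" where
  "h_S c y = (\<lambda>(u, s) (v, t). h8 u v + s \<bullet> t)"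

end

theory Submission
  imports Defs
begin

text \<open>\<open>S\<close> is covered by \<open>\<real>\<^sup>8 \<times> \<real>\<^sup>4\<close> with deck transformations whose linear parts are powers of
  \<open>A\<close>; constant tensors invariant under \<open>A\<close> therefore descend, which gives all the structures.
  The Obata connection vanishes in the charts because a symmetric bilinear map that commutes with
  anticommuting \<open>I\<close> and \<open>J\<close> is zero.

  Against a Kaehler metric \<open>g\<close> with form \<open>\<omega>\<close>: for \<open>a \<in> \<int>\<^sup>8\<close> the classes of \<open>a\<close> and \<open>I a\<close> span a
  torus in \<open>T\<^sup>8\<close>; let \<open>q(a)\<close> be the integral of \<open>\<omega>\<close> over it. As \<open>\<omega>\<close> is closed, \<open>q(a)\<close> is the same
  in every fibre, so the gluing by \<open>A\<close> gives \<open>q(A a) = q(a)\<close>. On the other hand the integrand is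
  \<open>g(a, a)\<close>, so by compactness \<open>q(a) \<ge> c |a|\<^sup>2\<close> with \<open>c > 0\<close>. But \<open>A\<close> has an unbounded orbit in
  \<open>\<int>\<^sup>8\<close>.\<close>

section \<open>The matrix\<close>

lemma UNIV_8: "UNIV = {1, 2, 3, 4, 5, 6, 7, 8::8}"
proof (rule card_seteq[symmetric])
  show "card (UNIV::8 set) \<le> card {1, 2, 3, 4, 5, 6, 7, 8::8}" by simp
qed auto

lemma exhaust_8: "x = 1 \<or> x = 2 \<or> x = 3 \<or> x = 4 \<or> x = 5 \<or> x = 6 \<or> x = 7 \<or> x = 8" for x :: 8
  using UNIV_I[of x] unfolding UNIV_8 by simp

lemma forall_8: "(\<forall>i::8. P i) \<longleftrightarrow> P 1 \<and> P 2 \<and> P 3 \<and> P 4 \<and> P 5 \<and> P 6 \<and> P 7 \<and> P 8"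
  by (metis exhaust_8)

lemma sum_8: "sum f (UNIV::8 set) = f 1 + f 2 + f 3 + f 4 + f 5 + f 6 + f 7 + f 8"
  unfolding UNIV_8 by (simp add: ac_simps)

lemma prod_8: "prod f (UNIV::8 set) = f 1 * f 2 * f 3 * f 4 * f 5 * f 6 * f 7 * f 8"
  unfolding UNIV_8 by (simp add: ac_simps)

lemma vector_8:
  "(vector [a1, a2, a3, a4, a5, a6, a7, a8] :: 'a::zero^8) $ 1 = a1"
  "(vector [a1, a2, a3, a4, a5, a6, a7, a8] :: 'a^8) $ 2 = a2"
  "(vector [a1, a2, a3, a4, a5, a6, a7, a8] :: 'a^8) $ 3 = a3"
  "(vector [a1, a2, a3, a4, a5, a6, a7, a8] :: 'a^8) $ 4 = a4"
  "(vector [a1, a2, a3, a4, a5, a6, a7, a8] :: 'a^8) $ 5 = a5"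
  "(vector [a1, a2, a3, a4, a5, a6, a7, a8] :: 'a^8) $ 6 = a6"
  "(vector [a1, a2, a3, a4, a5, a6, a7, a8] :: 'a^8) $ 7 = a7"
  "(vector [a1, a2, a3, a4, a5, a6, a7, a8] :: 'a^8) $ 8 = a8"
  unfolding vector_def by simp_all

text \<open>In the type \<open>8\<close> the numeral \<open>8\<close> is \<open>0\<close>, so the wellorder that
  triangularity refers to is \<open>8 < 1 < 2 < \<dots> < 7\<close>.\<close>
lemma det_matA: "det matA = 1"
proof -
  note order_8 = less_bit0_def bit0.Rep_numeral bit0.Rep_1 forall_8 vector_8
  \<comment> \<open>Gaussian elimination in the order 8, 1, ..., 7, recorded as
    \<open>L ** (R ** matA) = U\<close>. Since the pivot in row 3 is 2, row 5 is scaled by 2 to keep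
    the entries integral; hence \<open>det L = 2\<close>.\<close>
  define L :: "int^8^8" where "L = vector [
     vector [1, 0, 0, 0, 0, 0, 0, 2],
     vector [-1, 1, 0, 0, 0, 0, 0, -1],
     vector [3, -5, 1, 0, 0, 0, 0, 2],
     vector [1, -1, 0, 1, 0, 0, 0, 1],
     vector [-1, 1, 1, -2, 2, 0, 0, 0],
     vector [-1, 1, 1, -1, 0, 1, 0, -1],
     vector [0, -1, 1, -1, 1, 0, 1, 0],
     vector [0, 0, 0, 0, 0, 0, 0, 1]]"
  \<comment> \<open>Adding row 2 to row 1 avoids the zero pivot that clearing column 8 would
    otherwise leave at position (1, 1).\<close>
  define R :: "int^8^8" where "R = vector [
     vector [1, 1, 0, 0, 0, 0, 0, 0],
     vector [0, 1, 0, 0, 0, 0, 0, 0],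
     vector [0, 0, 1, 0, 0, 0, 0, 0],
     vector [0, 0, 0, 1, 0, 0, 0, 0],
     vector [0, 0, 0, 0, 1, 0, 0, 0],
     vector [0, 0, 0, 0, 0, 1, 0, 0],
     vector [0, 0, 0, 0, 0, 0, 1, 0],
     vector [0, 0, 0, 0, 0, 0, 0, 1]]"
  define U :: "int^8^8" where "U = vector [
     vector [-1, -3, -1, -1, -2, 1, 1, 0],
     vector [0, 1, 0, 0, 1, 0, 0, 0],
     vector [0, 0, 2, 2, -1, 0, -1, 0],
     vector [0, 0, 0, -1, 0, 1, 1, 0],
     vector [0, 0, 0, 0, 1, 0, 1, 0],
     vector [0, 0, 0, 0, 0, -1, 0, 0],
     vector [0, 0, 0, 0, 0, 0, 1, 0],
     vector [-1, -1, -1, 0, 0, 1, 0, -1]]"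
  have R_A: "R ** matA = vector [
     vector [1, -1, 1, -1, -2, -1, 1, 2],
     vector [0, -1, 0, -1, -1, 0, 1, 1],
     vector [-1, 0, 1, 0, 0, 1, 1, 1],
     vector [0, 1, 0, -1, 1, 1, 1, 0],
     vector [1, 1, 0, -1, 1, 0, 1, 0],
     vector [1, 0, -1, -1, 0, -1, 0, -1],
     vector [0, -1, -1, -1, -1, 0, 1, 0],
     vector [-1, -1, -1, 0, 0, 1, 0, -1]]"
    unfolding R_def matA_def by (simp add: vec_eq_iff forall_8 matrix_matrix_mult_def sum_8 vector_8)
  have "L ** (R ** matA) = U"
    unfolding R_A L_def U_def by (simp add: vec_eq_iff forall_8 matrix_matrix_mult_def sum_8 vector_8)
  then have "det L * (det R * det matA) = det U"
    by (metis det_mul)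
  moreover
  have "\<forall>i j. i < j \<longrightarrow> L $ i $ j = 0"
    unfolding L_def by (simp add: order_8)
  then have "det L = (\<Prod>i\<in>UNIV. L $ i $ i)"
    by (intro det_lowerdiagonal) blast
  then have "det L = 2"
    by (simp add: L_def vector_8 prod_8)
  moreover have "\<forall>i j. j < i \<longrightarrow> R $ i $ j = 0"
    unfolding R_def by (simp add: order_8)
  then have "det R = (\<Prod>i\<in>UNIV. R $ i $ i)"
    by (intro det_upperdiagonal) blast
  then have "det R = 1"
    by (simp add: R_def vector_8 prod_8)
  moreover have "\<forall>i j. j < i \<longrightarrow> U $ i $ j = 0"
    unfolding U_def by (simp add: order_8)
  then have "det U = (\<Prod>i\<in>UNIV. U $ i $ i)"
    by (intro det_upperdiagonal) blast
  then have "det U = 2"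
    by (simp add: U_def vector_8 prod_8)
  ultimately show ?thesis by simp
qed

section \<open>The automorphism and the linear structures in coordinates\<close>

definition A8 :: "real^8 \<Rightarrow> real^8" where
  "A8 x = (\<chi> i j. real_of_int (matA $ i $ j)) *v x"

text \<open>Since \<open>matA\<close> preserves \<open>h8\<close>, its inverse is its transpose conjugated by the
  diagonal matrix of \<open>h8\<close>.\<close>
definition A8_inv :: "real^8 \<Rightarrow> real^8" where
  "A8_inv x = vector [
     x $ 1 - x $ 3 + x $ 5 - x $ 6 + x $ 8,
     - x $ 2 + x $ 4 - x $ 5 + x $ 7 - x $ 8,
     x $ 1 + x $ 3 + x $ 6 - x $ 7 + x $ 8,
     - x $ 2 - x $ 4 + x $ 5 - x $ 6 + x $ 7,
     - x $ 1 + x $ 2 - x $ 4 + x $ 5 - x $ 7,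
     x $ 1 - x $ 3 + x $ 4 - x $ 6 + x $ 8,
     - x $ 2 + x $ 3 - x $ 4 + x $ 5 + x $ 7,
     - x $ 1 + x $ 2 - x $ 3 - x $ 6 - x $ 8]"

lemma A8_nth:
  "A8 x $ 1 = x $ 1 + x $ 3 - x $ 5 - x $ 6 + x $ 8"
  "A8 x $ 2 = - x $ 2 - x $ 4 - x $ 5 + x $ 7 + x $ 8"
  "A8 x $ 3 = - x $ 1 + x $ 3 + x $ 6 + x $ 7 + x $ 8"
  "A8 x $ 4 = x $ 2 - x $ 4 + x $ 5 + x $ 6 + x $ 7"
  "A8 x $ 5 = x $ 1 + x $ 2 - x $ 4 + x $ 5 + x $ 7"
  "A8 x $ 6 = x $ 1 - x $ 3 - x $ 4 - x $ 6 - x $ 8"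
  "A8 x $ 7 = - x $ 2 - x $ 3 - x $ 4 - x $ 5 + x $ 7"
  "A8 x $ 8 = - x $ 1 - x $ 2 - x $ 3 + x $ 6 - x $ 8"
  by (simp_all add: A8_def matA_def matrix_vector_mult_def sum_8 vector_8)

lemma A8_inv_nth:
  "A8_inv x $ 1 = x $ 1 - x $ 3 + x $ 5 - x $ 6 + x $ 8"
  "A8_inv x $ 2 = - x $ 2 + x $ 4 - x $ 5 + x $ 7 - x $ 8"
  "A8_inv x $ 3 = x $ 1 + x $ 3 + x $ 6 - x $ 7 + x $ 8"
  "A8_inv x $ 4 = - x $ 2 - x $ 4 + x $ 5 - x $ 6 + x $ 7"
  "A8_inv x $ 5 = - x $ 1 + x $ 2 - x $ 4 + x $ 5 - x $ 7"
  "A8_inv x $ 6 = x $ 1 - x $ 3 + x $ 4 - x $ 6 + x $ 8"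
  "A8_inv x $ 7 = - x $ 2 + x $ 3 - x $ 4 + x $ 5 + x $ 7"
  "A8_inv x $ 8 = - x $ 1 + x $ 2 - x $ 3 - x $ 6 - x $ 8"
  by (simp_all add: A8_inv_def vector_8)

lemma linear_A8: "linear A8"
  unfolding A8_def by (rule matrix_vector_mul_linear)

lemma linear_A8_inv: "linear A8_inv"
  by (rule linearI) (simp_all add: vec_eq_iff forall_8 A8_inv_nth algebra_simps)

lemma A8_A8_inv [simp]: "A8 (A8_inv x) = x"
  by (simp add: vec_eq_iff forall_8 A8_nth A8_inv_nth)

lemma A8_inv_A8 [simp]: "A8_inv (A8 x) = x"
  by (simp add: vec_eq_iff forall_8 A8_nth A8_inv_nth)

lemma I8_nth:
  "I8 v $ 1 = - v $ 3" "I8 v $ 2 = - v $ 4" "I8 v $ 3 = v $ 1" "I8 v $ 4 = v $ 2"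
  "I8 v $ 5 = v $ 7" "I8 v $ 6 = v $ 8" "I8 v $ 7 = - v $ 5" "I8 v $ 8 = - v $ 6"
  by (simp_all add: I8_def axis_def)

lemma J8_nth:
  "J8 v $ 1 = v $ 5" "J8 v $ 2 = v $ 6" "J8 v $ 3 = v $ 7" "J8 v $ 4 = v $ 8"
  "J8 v $ 5 = - v $ 1" "J8 v $ 6 = - v $ 2" "J8 v $ 7 = - v $ 3" "J8 v $ 8 = - v $ 4"
  by (simp_all add: J8_def axis_def)

lemma I8_A8: "I8 (A8 x) = A8 (I8 x)"
  by (simp add: vec_eq_iff forall_8 A8_nth I8_nth)

lemma J8_A8: "J8 (A8 x) = A8 (J8 x)"
  by (simp add: vec_eq_iff forall_8 A8_nth J8_nth)

lemma h8_A8: "h8 (A8 x) (A8 y) = h8 x y"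
  by (simp add: h8_def A8_nth algebra_simps)

section \<open>The lattice and the growth of an orbit in it\<close>

definition lattice8 :: "(real^8) set" where
  "lattice8 = {x. \<forall>i. x $ i \<in> \<int>}"

lemma lattice8_A8: "x \<in> lattice8 \<Longrightarrow> A8 x \<in> lattice8"
  by (simp add: lattice8_def forall_8 A8_nth)

lemma lattice8_A8_inv: "x \<in> lattice8 \<Longrightarrow> A8_inv x \<in> lattice8"
  by (simp add: lattice8_def forall_8 A8_inv_nth)

lemma lattice8_I8: "x \<in> lattice8 \<Longrightarrow> I8 x \<in> lattice8"
  by (simp add: lattice8_def forall_8 I8_nth)

lemma lattice8_add: "x \<in> lattice8 \<Longrightarrow> y \<in> lattice8 \<Longrightarrow> x + y \<in> lattice8"
  and lattice8_diff: "x \<in> lattice8 \<Longrightarrow> y \<in> lattice8 \<Longrightarrow> x - y \<in> lattice8"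
  and lattice8_minus: "x \<in> lattice8 \<Longrightarrow> - x \<in> lattice8"
  and lattice8_0: "0 \<in> lattice8"
  by (simp_all add: lattice8_def)

lemma closed_lattice8: "closed lattice8"
proof -
  have "closed {x :: real^8. x $ i \<in> \<int>}" for i
    using continuous_closed_vimage[OF closed_Ints, of "\<lambda>x :: real^8. x $ i"]
    by (simp add: vimage_def)
  then have "closed {x :: real^8. \<forall>i. x $ i \<in> \<int>}"
    by (intro closed_Collect_all)
  then show ?thesis by (simp add: lattice8_def)
qed

lemma f_A_eq: "f_A P = A8 ` P"
  by (simp add: f_A_def A8_def)

text \<open>The sublattice spanned by \<open>e\<^sub>1\<close> and the vector \<open>w\<close> below is invariant under \<open>A\<^sup>4\<close>,
  which acts on it by the hyperbolic matrix with rows \<open>(17, 24)\<close> and \<open>(12, 17)\<close>.\<close>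
lemma A8_orbit_unbounded:
  "\<exists>k a. a = (A8 ^^ k) (axis 1 1) \<and> a \<in> lattice8 \<and> real n \<le> a $ 1"
proof -
  define w :: "real^8" where "w = vector [0, 1, 1, -1, -1, -1, 0, -1]"
  define z :: "real \<Rightarrow> real \<Rightarrow> real^8" where "z s t = s *\<^sub>R axis 1 1 + t *\<^sub>R w" for s t
  have z_nth: "z s t $ 1 = s" "z s t $ 2 = t" "z s t $ 3 = t" "z s t $ 4 = - t"
    "z s t $ 5 = - t" "z s t $ 6 = - t" "z s t $ 7 = 0" "z s t $ 8 = - t" for s t
    by (simp_all add: z_def w_def vector_8 axis_def)
  \<comment> \<open>The square of \<open>A8\<close> already preserves the plane, but by a matrix
    with negative entries. Squaring once more makes them positive, so that an induction can bound
    \<open>s\<close> from below while keeping \<open>t\<close> nonnegative.\<close>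
  have "A8 (A8 (z s t)) = z (- 3 * s - 4 * t) (- 2 * s - 3 * t)" for s t
    by (simp add: vec_eq_iff forall_8 A8_nth z_nth)
  then have step: "A8 (A8 (A8 (A8 (z s t)))) = z (17 * s + 24 * t) (12 * s + 17 * t)" for s t
    by (simp add: algebra_simps)
  have "\<exists>s t. (A8 ^^ (4 * n)) (axis 1 1) = z s t \<and> s \<in> \<int> \<and> t \<in> \<int> \<and> 1 + real n \<le> s \<and> 0 \<le> t"
  proof (induction n)
    case 0
    have "axis 1 1 = z 1 0" by (simp add: z_def)
    then show ?case by (intro exI[of _ 1] exI[of _ 0]) simp
  next
    case (Suc n)
    then obtain s t where st: "(A8 ^^ (4 * n)) (axis 1 1) = z s t" "s \<in> \<int>" "t \<in> \<int>"
      "1 + real n \<le> s" "0 \<le> t" by blast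
    have "(A8 ^^ (4 * Suc n)) (axis 1 1) = z (17 * s + 24 * t) (12 * s + 17 * t)"
    proof -
      have "4 * Suc n = Suc (Suc (Suc (Suc (4 * n))))" by simp
      then show ?thesis using st(1) by (simp only: funpow.simps o_apply step)
    qed
    with st(2-) show ?case
      by (intro exI[of _ "17 * s + 24 * t"] exI[of _ "12 * s + 17 * t"]) auto
  qed
  then obtain s t where st: "(A8 ^^ (4 * n)) (axis 1 1) = z s t" "s \<in> \<int>" "t \<in> \<int>"
    "1 + real n \<le> s" by blast
  have "z s t \<in> lattice8"
    using st(2,3) by (simp add: lattice8_def forall_8 z_nth)
  with st show ?thesis
    by (intro exI[of _ "4 * n"] exI[of _ "z s t"]) (simp add: z_nth)
qed

section \<open>Integer powers of the automorphism, the linear parts of the deck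
  transformations\<close>

definition A8_pow :: "int \<Rightarrow> real^8 \<Rightarrow> real^8" where
  "A8_pow n = (if 0 \<le> n then A8 ^^ nat n else A8_inv ^^ nat (- n))"

lemma A8_pow_0 [simp]: "A8_pow 0 x = x"
  by (simp add: A8_pow_def)

lemma A8_pow_1 [simp]: "A8_pow 1 x = A8 x"
  by (simp add: A8_pow_def)

lemma A8_A8_pow: "A8 (A8_pow n x) = A8_pow (n + 1) x"
proof (cases "0 \<le> n")
  case True
  then have "nat (n + 1) = Suc (nat n)" by simp
  with True show ?thesis by (simp add: A8_pow_def)
next
  case False
  then have "nat (- n) = Suc (nat (- (n + 1)))" by simp
  with False show ?thesis by (auto simp: A8_pow_def)
qed

lemma A8_inv_A8_pow: "A8_inv (A8_pow n x) = A8_pow (n - 1) x"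
  using arg_cong[OF A8_A8_pow[of "n - 1" x], of A8_inv] by simp

text \<open>The predicate is on functions, so linearity and compatibility with the tensors reduce to
  closure under composition with \<open>A8\<close> and \<open>A8_inv\<close>.\<close>

lemma A8_pow_induct [case_names zero step step_inv]:
  assumes "P (\<lambda>x. x)" "\<And>f. P f \<Longrightarrow> P (\<lambda>x. A8 (f x))" "\<And>f. P f \<Longrightarrow> P (\<lambda>x. A8_inv (f x))"
  shows "P (A8_pow n)"
proof (induction n rule: int_induct[of _ 0])
  case base
  have "A8_pow 0 = (\<lambda>x. x)" by (simp add: fun_eq_iff)
  then show ?case using assms(1) by simp
next
  case (step1 i)
  have "A8_pow (i + 1) = (\<lambda>x. A8 (A8_pow i x))" by (simp add: fun_eq_iff A8_A8_pow)
  then show ?case using assms(2)[OF step1.IH] by simp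
next
  case (step2 i)
  have "A8_pow (i - 1) = (\<lambda>x. A8_inv (A8_pow i x))" by (simp add: fun_eq_iff A8_inv_A8_pow)
  then show ?case using assms(3)[OF step2.IH] by simp
qed

lemma linear_A8_pow: "linear (A8_pow n)"
proof (induction n rule: A8_pow_induct)
  case zero
  show ?case by (rule linear_ident)
next
  case (step f)
  then show ?case using linear_compose[OF step linear_A8] by (simp add: comp_def)
next
  case (step_inv f)
  then show ?case using linear_compose[OF step_inv linear_A8_inv] by (simp add: comp_def)
qed

lemma I8_A8_pow: "I8 (A8_pow n x) = A8_pow n (I8 x)"
proof (induction n rule: A8_pow_induct)
  case (step_inv f)
  have "I8 (A8_inv y) = A8_inv (I8 y)" for y
    using I8_A8[of "A8_inv y"] by (metis A8_A8_inv A8_inv_A8)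
  with step_inv show ?case by simp
qed (simp_all add: I8_A8)

lemma J8_A8_pow: "J8 (A8_pow n x) = A8_pow n (J8 x)"
proof (induction n rule: A8_pow_induct)
  case (step_inv f)
  have "J8 (A8_inv y) = A8_inv (J8 y)" for y
    using J8_A8[of "A8_inv y"] by (metis A8_A8_inv A8_inv_A8)
  with step_inv show ?case by simp
qed (simp_all add: J8_A8)

lemma h8_A8_pow: "h8 (A8_pow n x) (A8_pow n y) = h8 x y"
proof (induction n rule: A8_pow_induct)
  case (step_inv f)
  have "h8 (A8_inv u) (A8_inv v) = h8 u v" for u v
    using h8_A8[of "A8_inv u" "A8_inv v"] by simp
  with step_inv show ?case by simp
qed (simp_all add: h8_A8)

section \<open>Quotients of Euclidean space with locally affine transition maps\<close>

lemma has_derivative_locally_affine: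
  fixes f :: "'a::euclidean_space \<Rightarrow> 'b::real_normed_vector"
  assumes "open W" "x \<in> W" "linear L" "\<And>y. y \<in> W \<Longrightarrow> f y = L y + c"
  shows "(f has_derivative L) (at x)"
proof -
  have "((\<lambda>y. L y + c) has_derivative L) (at x)"
    using assms(3) by (intro has_derivative_add_const linear_imp_has_derivative)
  then show ?thesis
    by (rule has_derivative_transform_within_open[OF _ assms(1,2)]) (simp add: assms(4))
qed

lemma frechet_derivative_eqI: "(f has_derivative D) (at x) \<Longrightarrow> frechet_derivative f (at x) = D"
  by (rule frechet_derivative_at[symmetric])

text \<open>A directional derivative of a locally affine map is locally constant, hence again
  locally affine, so the induction on \<open>k\<close> reproduces its own hypothesis.\<close>

lemma Ck_on_locally_affine:
  fixes f :: "'a::euclidean_space \<Rightarrow> 'b::real_normed_vector"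
  assumes "\<And>x. x \<in> U \<Longrightarrow> \<exists>W L c. open W \<and> x \<in> W \<and> linear L \<and> (\<forall>y\<in>W. f y = L y + c)"
  shows "Ck_on k U f"
  using assms
proof (induction k arbitrary: f)
  case 0
  have "isCont f x" if "x \<in> U" for x
  proof -
    from 0[OF that] obtain W L c where "open W" "x \<in> W" "linear L" "\<forall>y\<in>W. f y = L y + c"
      by blast
    then have "(f has_derivative L) (at x)"
      by (intro has_derivative_locally_affine) auto
    then show ?thesis by (rule has_derivative_continuous)
  qed
  then show ?case by (simp add: continuous_at_imp_continuous_on)
next
  case (Suc k)
  have "f differentiable (at x)" if "x \<in> U" for x
  proof -
    from Suc.prems[OF that] obtain W L c where "open W" "x \<in> W" "linear L" "\<forall>y\<in>W. f y = L y + c"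
      by blast
    then have "(f has_derivative L) (at x)"
      by (intro has_derivative_locally_affine) auto
    then show ?thesis by (rule differentiableI)
  qed
  moreover have "Ck_on k U (\<lambda>x. frechet_derivative f (at x) v)" for v
  proof (rule Suc.IH)
    fix x assume "x \<in> U"
    from Suc.prems[OF this] obtain W L c where W: "open W" "x \<in> W" "linear L" "\<forall>y\<in>W. f y = L y + c"
      by blast
    have "frechet_derivative f (at y) v = (\<lambda>_. 0) y + L v" if "y \<in> W" for y
    proof -
      have "(f has_derivative L) (at y)"
        using W that by (intro has_derivative_locally_affine) auto
      then show ?thesis by (simp add: frechet_derivative_eqI)
    qed
    then show "\<exists>W L c. open W \<and> x \<in> W \<and> linear L \<and> (\<forall>y\<in>W. frechet_derivative f (at y) v = L y + c)"
      using W(1,2)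
      by (intro exI[of _ W] exI[of _ "\<lambda>_. 0"] exI[of _ "L v"]) (auto intro: linear_zero)
  qed
  ultimately show ?case by simp
qed

lemma smooth_on_locally_affine:
  fixes f :: "'a::euclidean_space \<Rightarrow> 'b::real_normed_vector"
  assumes "\<And>x. x \<in> U \<Longrightarrow> \<exists>W L c. open W \<and> x \<in> W \<and> linear L \<and> (\<forall>y\<in>W. f y = L y + c)"
  shows "smooth_on U f"
  unfolding smooth_on_def using Ck_on_locally_affine[OF assms] by blast

lemma smooth_on_affine: "linear L \<Longrightarrow> smooth_on U (\<lambda>x. L x + c)"
  by (rule smooth_on_locally_affine) blast

lemma smooth_on_const: "smooth_on U (\<lambda>x. c)"
  using smooth_on_affine[OF linear_zero, of U c] by simp

lemma smooth_on_ident: "smooth_on U (\<lambda>x. x)"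
  using smooth_on_affine[OF linear_ident, of U 0] by simp

text \<open>\<open>H\<close> contains the linear parts of affine deck transformations relating the
  points of each fibre of \<open>p\<close>. Local injectivity provides the charts; closedness of the
  fibre relation provides the Hausdorff property.\<close>

locale affine_cover =
  fixes p :: "'b::euclidean_space \<Rightarrow> 'm" and X :: "'m topology" and H :: "('b \<Rightarrow> 'b) set"
  assumes quotient_map_p: "quotient_map euclidean X p"
    and deck: "p x = p y \<Longrightarrow> \<exists>L\<in>H. \<exists>a. y = L x + a \<and> (\<forall>z. p (L z + a) = p z)"
    and linear_H: "L \<in> H \<Longrightarrow> linear L"
    and locally_inj: "\<exists>U. open U \<and> x \<in> U \<and> inj_on p U"
    and closed_rel: "closed {(x, y). p x = p y}"
begin

lemma continuous_affine: "linear L \<Longrightarrow> continuous_on S (\<lambda>z. L z + a)" for L :: "'b \<Rightarrow> 'b"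
  by (rule continuous_on_add[OF linear_continuous_on[OF linear_conv_bounded_linear[THEN iffD1]] continuous_on_const])

lemma topspace_eq: "topspace X = range p"
  using quotient_imp_surjective_map[OF quotient_map_p] by simp

lemma openin_iff: "openin X V \<longleftrightarrow> V \<subseteq> range p \<and> open (p -` V)"
proof
  assume V: "openin X V"
  then have "V \<subseteq> range p" using openin_subset topspace_eq by metis
  with V show "V \<subseteq> range p \<and> open (p -` V)"
    using quotient_map_p by (simp add: quotient_map_def topspace_eq vimage_def)
next
  assume "V \<subseteq> range p \<and> open (p -` V)"
  then show "openin X V"
    using quotient_map_p by (auto simp: quotient_map_def topspace_eq vimage_def)
qed

text \<open>A deck transformation carries any point of the saturation of \<open>U\<close> into
  \<open>U\<close>; the preimage of \<open>U\<close> under it is an open neighbourhood inside the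
  saturation.\<close>

lemma openin_image:
  assumes "open U"
  shows "openin X (p ` U)"
proof -
  have "\<exists>W. open W \<and> y \<in> W \<and> W \<subseteq> p -` p ` U" if "y \<in> p -` p ` U" for y
  proof -
    from that obtain x where x: "x \<in> U" "p y = p x" by auto
    from deck[OF x(2)] obtain L a where L: "L \<in> H" "x = L y + a" "\<And>z. p (L z + a) = p z" by blast
    have "open ((\<lambda>z. L z + a) -` U)"
      using assms continuous_affine[OF linear_H[OF L(1)], of UNIV] by (simp add: continuous_on_open_vimage)
    moreover have "(\<lambda>z. L z + a) -` U \<subseteq> p -` p ` U"
      using L(3) by (metis (mono_tags, lifting) image_eqI subsetI vimage_eq)
    ultimately show ?thesis using x L by blast
  qed
  then have "open (p -` p ` U)" by (subst open_subopen) blast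
  then show ?thesis by (auto simp: openin_iff)
qed

lemma open_map_p: "open_map euclidean X p"
  using openin_image by (simp add: open_map_def)

lemma continuous_map_p: "continuous_map euclidean X p"
  by (rule quotient_imp_continuous_map[OF quotient_map_p])

lemma second_countable_X: "second_countable X"
proof (rule second_countable_open_map_image[OF continuous_map_p open_map_p])
  show "p ` topspace euclidean = topspace X" by (simp add: topspace_eq)
  show "second_countable (euclidean :: 'b topology)"
  proof -
    obtain B :: "'b set set" where B: "countable B" "topological_basis B"
      using ex_countable_basis by blast
    have "\<exists>V\<in>B. x \<in> V \<and> V \<subseteq> U" if "open U" "x \<in> U" for U x
      by (rule topological_basisE[OF B(2) that]) blast
    then show ?thesis
      unfolding second_countable_def
      by (intro exI[of _ B]) (simp add: B(1) topological_basis_open[OF B(2)])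
  qed
qed

text \<open>A product neighbourhood \<open>U \<times> V\<close> that misses the closed fibre
  relation has disjoint images, and these are open because \<open>p\<close> is an open map.\<close>

lemma Hausdorff_X: "Hausdorff_space X"
  unfolding Hausdorff_space_def
proof (intro allI impI, elim conjE)
  fix P Q assume "P \<in> topspace X" "Q \<in> topspace X" "P \<noteq> Q"
  then obtain x y where xy: "P = p x" "Q = p y" "p x \<noteq> p y" by (auto simp: topspace_eq)
  have "open (- {(x, y). p x = p y})" using closed_rel by (simp add: open_Compl)
  then obtain U V where "open U" "open V" "x \<in> U" "y \<in> V" "U \<times> V \<subseteq> - {(x, y). p x = p y}"
    using xy(3) by (elim open_prod_elim[of _ "(x, y)"]) auto
  then show "\<exists>U V. openin X U \<and> openin X V \<and> P \<in> U \<and> Q \<in> V \<and> disjnt U V"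
    using xy openin_image by (intro exI[of _ "p ` U"] exI[of _ "p ` V"]) (auto simp: disjnt_def)
qed

lemma atlasE:
  assumes "c \<in> quotient_atlas p"
  obtains U where "c = (p ` U, inv_into U p)" "open U" "inj_on p U"
  using assms by (auto simp: quotient_atlas_def)

lemma chart_image_eq [simp]: "inj_on p U \<Longrightarrow> chart_image (p ` U, inv_into U p) = U"
  by (auto simp: chart_image_def)

lemma open_chart_image: "c \<in> quotient_atlas p \<Longrightarrow> open (chart_image c)"
  by (auto elim: atlasE)

lemma homeomorphic_map_chart:
  assumes "open U" "inj_on p U"
  shows "homeomorphic_map (subtopology X (p ` U)) (top_of_set U) (inv_into U p)"
proof -
  have "homeomorphic_map (top_of_set U) (subtopology X (p ` U)) p"
  proof (rule bijective_open_imp_homeomorphic_map)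
    show "continuous_map (top_of_set U) (subtopology X (p ` U)) p"
      using continuous_map_p by (auto simp: continuous_map_in_subtopology continuous_map_from_subtopology)
    show "open_map (top_of_set U) (subtopology X (p ` U)) p"
      unfolding open_map_def
    proof (intro allI impI)
      fix W assume "openin (top_of_set U) W"
      then have "open W" "W \<subseteq> U" using assms(1) by (auto simp: openin_open_eq)
      then show "openin (subtopology X (p ` U)) (p ` W)"
        using openin_image by (auto simp: openin_subtopology intro!: exI[of _ "p ` W"])
    qed
    show "p ` topspace (top_of_set U) = topspace (subtopology X (p ` U))"
      by (auto simp: topspace_eq)
    show "inj_on p (topspace (top_of_set U))" using assms(2) by simp
  qed
  then obtain q where q: "homeomorphic_maps (top_of_set U) (subtopology X (p ` U)) p q"
    by (auto simp: homeomorphic_map_maps)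
  \<comment> \<open>The abstract inverse \<open>q\<close> is identified with the coordinate map
    chosen in the atlas, on the chart domain only.\<close>
  have "inv_into U p y = q y" if "y \<in> topspace (subtopology X (p ` U))" for y
    using q that assms(2) by (fastforce simp: homeomorphic_maps_def)
  then show ?thesis
    using q homeomorphic_map_eq[of "subtopology X (p ` U)" "top_of_set U" q "inv_into U p"]
    by (metis homeomorphic_map_maps homeomorphic_maps_sym)
qed

text \<open>By injectivity of \<open>p\<close> on \<open>V\<close>, the only point of
  \<open>V\<close> over \<open>p z\<close> is \<open>L z + a\<close> as long as that point lies in
  \<open>V\<close>. The deck transformation is prescribed here, so that lifts can later be compared
  along a given one.\<close>

lemma transition_deck:
  assumes "inj_on p U" "open U" "inj_on p V" "open V" "x \<in> U" "L x + a \<in> V" "linear L"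
    and "\<And>z. p (L z + a) = p z"
  obtains W where "open W" "x \<in> W" "W \<subseteq> overlap (p ` U, inv_into U p) (p ` V, inv_into V p)"
    "\<And>z. z \<in> W \<Longrightarrow> transition (p ` U, inv_into U p) (p ` V, inv_into V p) z = L z + a"
proof
  define W where "W = U \<inter> (\<lambda>z. L z + a) -` V"
  show "open W" "x \<in> W"
    using assms continuous_affine[OF assms(7), of UNIV]
    by (auto simp: W_def continuous_on_open_vimage)
  fix z assume z: "z \<in> W"
  then have "inv_into (p ` U) (inv_into U p) z = p z"
    using assms(1) by (intro inv_into_f_eq) (auto simp: W_def inj_on_def)
  moreover have "inv_into V p (p z) = L z + a"
    using z assms(3,8) by (intro inv_into_f_eq) (auto simp: W_def)
  ultimately show "transition (p ` U, inv_into U p) (p ` V, inv_into V p) z = L z + a"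
    by (simp add: transition_def)
next
  show "U \<inter> (\<lambda>z. L z + a) -` V \<subseteq> overlap (p ` U, inv_into U p) (p ` V, inv_into V p)"
  proof
    fix z assume z: "z \<in> U \<inter> (\<lambda>z. L z + a) -` V"
    then have "z = inv_into U p (p z)" using assms(1) by simp
    moreover have "p z \<in> p ` U \<inter> p ` V" using z assms(8)[of z] by (metis IntE IntI imageI vimageE)
    ultimately show "z \<in> overlap (p ` U, inv_into U p) (p ` V, inv_into V p)"
      unfolding overlap_def by auto
  qed
qed

text \<open>A point of the overlap comes with one lift in \<open>U\<close> and one in
  \<open>V\<close>, and \<open>deck\<close> relates the two.\<close>

lemma overlapE:
  assumes "inj_on p U" "open U" "inj_on p V" "open V" "x \<in> overlap (p ` U, inv_into U p) (p ` V, inv_into V p)"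
  obtains L a where "L \<in> H" "L x + a \<in> V" "\<And>z. p (L z + a) = p z" "x \<in> U"
proof -
  from assms(5) obtain y where y: "y \<in> p ` U" "y \<in> p ` V" "x = inv_into U p y"
    by (auto simp: overlap_def)
  then have x: "x \<in> U" "p x = y" by (auto simp: inv_into_into f_inv_into_f)
  from y(2) obtain v where "v \<in> V" "p x = p v" using x by auto
  with deck[OF this(2)] x that show ?thesis by metis
qed

lemma transition_locally_affine:
  assumes "c \<in> quotient_atlas p" "d \<in> quotient_atlas p" "x \<in> overlap c d"
  obtains W L a where "open W" "x \<in> W" "L \<in> H" "\<And>z. z \<in> W \<Longrightarrow> transition c d z = L z + a"
proof -
  obtain U where U: "c = (p ` U, inv_into U p)" "open U" "inj_on p U" using assms(1) by (rule atlasE)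
  obtain V where V: "d = (p ` V, inv_into V p)" "open V" "inj_on p V" using assms(2) by (rule atlasE)
  obtain L a where L: "L \<in> H" "L x + a \<in> V" "\<And>z. p (L z + a) = p z" "x \<in> U"
    using assms(3) U V by (auto elim: overlapE)
  obtain W where "open W" "x \<in> W" "\<And>z. z \<in> W \<Longrightarrow> transition c d z = L z + a"
    using transition_deck[OF U(3,2) V(3,2) L(4,2) linear_H[OF L(1)] L(3)] unfolding U(1) V(1) by metis
  with L(1) show ?thesis using that by blast
qed

lemma smooth_manifold_X: "smooth_manifold X (quotient_atlas p)"
  unfolding smooth_manifold_def
proof (intro conjI ballI)
  show "Hausdorff_space X" by (rule Hausdorff_X)
  show "second_countable X" by (rule second_countable_X)
  show "(\<Union>c\<in>quotient_atlas p. fst c) = topspace X"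
  proof
    show "topspace X \<subseteq> (\<Union>c\<in>quotient_atlas p. fst c)"
    proof
      fix P assume "P \<in> topspace X"
      then obtain x where x: "P = p x" by (auto simp: topspace_eq)
      obtain U where "open U" "x \<in> U" "inj_on p U" using locally_inj by blast
      with x show "P \<in> (\<Union>c\<in>quotient_atlas p. fst c)"
        by (intro UN_I[of "(p ` U, inv_into U p)"]) (auto simp: quotient_atlas_def)
    qed
  qed (auto simp: quotient_atlas_def topspace_eq)
  fix c assume c: "c \<in> quotient_atlas p"
  obtain U where U: "c = (p ` U, inv_into U p)" "open U" "inj_on p U" using c by (rule atlasE)
  show "openin X (fst c)" "open (chart_image c)"
    "homeomorphic_map (subtopology X (fst c)) (top_of_set (chart_image c)) (snd c)"
    using U by (simp_all add: openin_image homeomorphic_map_chart)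
  fix d assume d: "d \<in> quotient_atlas p"
  show "smooth_on (overlap c d) (transition c d)"
    by (rule smooth_on_locally_affine) (metis transition_locally_affine[OF c d] linear_H)
qed

text \<open>The first part reduces tensor transformation laws to invariance under \<open>H\<close>;
  the second removes the inhomogeneous term from the transformation law of connections.\<close>

lemma transition_derivative:
  assumes "c \<in> quotient_atlas p" "d \<in> quotient_atlas p" "x \<in> overlap c d"
  shows "frechet_derivative (transition c d) (at x) \<in> H"
    and "frechet_derivative (\<lambda>y. frechet_derivative (transition c d) (at y) v) (at x) = (\<lambda>u. 0)"
proof -
  obtain W L a where W: "open W" "x \<in> W" "L \<in> H" "\<And>z. z \<in> W \<Longrightarrow> transition c d z = L z + a"
    using transition_locally_affine[OF assms] by blast
  have D: "frechet_derivative (transition c d) (at y) = L" if "y \<in> W" for y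
    by (rule frechet_derivative_eqI) (rule has_derivative_locally_affine[OF W(1) that linear_H[OF W(3)] W(4)])
  then show "frechet_derivative (transition c d) (at x) \<in> H" using W by simp
  have "((\<lambda>y. frechet_derivative (transition c d) (at y) v) has_derivative (\<lambda>u. 0)) (at x)"
    by (rule has_derivative_transform_within_open[OF has_derivative_const W(1,2)]) (simp add: D)
  then show "frechet_derivative (\<lambda>y. frechet_derivative (transition c d) (at y) v) (at x) = (\<lambda>u. 0)"
    by (rule frechet_derivative_eqI)
qed

section \<open>Constant tensors on the cover that descend to the quotient\<close>

lemma complex_structure_const:
  assumes "linear T" "\<And>v. T (T v) = - v" "\<And>L v. L \<in> H \<Longrightarrow> T (L v) = L (T v)"
  shows "complex_structure (quotient_atlas p) (\<lambda>_ _. T)"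
proof -
  have "integrable_structure (quotient_atlas p) (\<lambda>_ _. T)"
    unfolding integrable_structure_def
  proof (intro ballI)
    fix c and x :: 'b assume c: "c \<in> quotient_atlas p" and x: "x \<in> chart_image c"
    \<comment> \<open>The chart itself is a holomorphic coordinate system: \<open>\<psi>\<close> is
      the identity on the chart image and \<open>J0\<close> is \<open>T\<close>.\<close>
    have "inv_into (chart_image c) (\<lambda>x. x) y = y" if "y \<in> chart_image c" for y
      using that by (intro inv_into_f_eq) auto
    then have "smooth_on (chart_image c) (inv_into (chart_image c) (\<lambda>x. x))"
      using open_chart_image[OF c]
      by (intro smooth_on_locally_affine exI[of _ "chart_image c"] exI[of _ "\<lambda>x. x"] exI[of _ 0])
        (simp add: linear_ident)
    then show "\<exists>W (\<psi> :: 'b \<Rightarrow> 'b) J0.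
     open W \<and> x \<in> W \<and> W \<subseteq> chart_image c \<and>
     inj_on \<psi> W \<and> open (\<psi> ` W) \<and> smooth_on W \<psi> \<and> smooth_on (\<psi> ` W) (inv_into W \<psi>) \<and>
     linear J0 \<and> (\<forall>v. J0 (J0 v) = - v) \<and>
     (\<forall>y\<in>W. \<forall>v. frechet_derivative \<psi> (at y) (T v) = J0 (frechet_derivative \<psi> (at y) v))"
      using smooth_on_ident x open_chart_image[OF c] assms
      by (intro exI[of _ "chart_image c"] exI[of _ "\<lambda>x. x"] exI[of _ T]) simp
  qed
  then show ?thesis
    using assms transition_derivative(1)
    by (simp add: complex_structure_def endomorphism_field_def smooth_on_const)
qed

lemma bilinear_field_const:
  assumes "bilinear b" "\<And>L u v. L \<in> H \<Longrightarrow> b (L u) (L v) = b u v"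
  shows "bilinear_field (quotient_atlas p) (\<lambda>_ _. b)"
  using assms transition_derivative(1) by (simp add: bilinear_field_def smooth_on_const)

lemma closed_two_form_const:
  assumes "bilinear b" "\<And>u v. b v u = - b u v" "\<And>L u v. L \<in> H \<Longrightarrow> b (L u) (L v) = b u v"
  shows "closed_two_form (quotient_atlas p) (\<lambda>_ _. b)"
  unfolding closed_two_form_def two_form_def
  by (intro conjI bilinear_field_const[OF assms(1,3)] ballI allI assms(2))
    (simp_all add: exterior_derivative_def)

text \<open>Affine coordinate changes have vanishing second derivative, so zero Christoffel maps are
  consistent on overlaps.\<close>

lemma connection_zero: "connection (quotient_atlas p) (\<lambda>_ _ _ _. 0)"
  using transition_derivative linear_0[OF linear_H]
  by (simp add: connection_def smooth_on_const bilinear_def linear_zero)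

text \<open>Pulls a field back to a single function on the whole cover. The neighbourhood is an
  arbitrary choice; for bilinear fields \<open>lift_eq\<close> shows that the value does not depend
  on it.\<close>

definition lift :: "('m, 'b, 't) field \<Rightarrow> 'b \<Rightarrow> 't" where
  "lift g x = (let U = SOME U. open U \<and> x \<in> U \<and> inj_on p U in g (p ` U, inv_into U p) x)"

text \<open>The transformation law between the given chart around \<open>x\<close> and the chosen
  one around \<open>L x + a\<close>, where the transition has derivative \<open>L\<close>. The
  identity gives independence of the choice; a general \<open>L\<close> gives deck
  invariance.\<close>

lemma lift_deck:
  assumes g: "bilinear_field (quotient_atlas p) g"
    and U: "open U" "inj_on p U" "x \<in> U"
    and L: "linear L" "\<And>z. p (L z + a) = p z"
  shows "lift g (L x + a) (L u) (L v) = g (p ` U, inv_into U p) x u v"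
proof -
  define V where "V = (SOME V. open V \<and> L x + a \<in> V \<and> inj_on p V)"
  have V: "open V" "L x + a \<in> V" "inj_on p V"
    using someI_ex[OF locally_inj[of "L x + a"]] by (simp_all add: V_def)
  let ?c = "(p ` U, inv_into U p)" and ?d = "(p ` V, inv_into V p)"
  obtain W where W: "open W" "x \<in> W" "W \<subseteq> overlap ?c ?d"
    "\<And>z. z \<in> W \<Longrightarrow> transition ?c ?d z = L z + a"
    using transition_deck[OF U(2,1) V(3,1) U(3) V(2) L] by blast
  have "frechet_derivative (transition ?c ?d) (at x) = L"
    by (rule frechet_derivative_eqI) (rule has_derivative_locally_affine[OF W(1,2) L(1) W(4)])
  moreover have "?c \<in> quotient_atlas p" "?d \<in> quotient_atlas p"
    using U V by (auto simp: quotient_atlas_def)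
  ultimately have "g ?d (transition ?c ?d x) (L u) (L v) = g ?c x u v"
    using g W(2,3) by (auto simp: bilinear_field_def Let_def)
  then show ?thesis using W(2,4) by (simp add: lift_def Let_def V_def)
qed

lemma lift_eq:
  assumes "bilinear_field (quotient_atlas p) g" "open U" "inj_on p U" "x \<in> U"
  shows "lift g x u v = g (p ` U, inv_into U p) x u v"
  using lift_deck[OF assms, of "\<lambda>z. z" 0 u v] by (simp add: linear_ident)

lemma lift_invariant:
  assumes "bilinear_field (quotient_atlas p) g" "linear L" "\<And>z. p (L z + a) = p z"
  shows "lift g (L x + a) (L u) (L v) = lift g x u v"
  using locally_inj[of x] lift_deck[OF assms(1) _ _ _ assms(2,3), of _ x u v] lift_eq[OF assms(1)]
  by metis

text \<open>Near \<open>x\<close> the lift coincides with a smooth representative in one chart, and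
  differentiation is local. First order is all that the period argument asks for.\<close>

lemma lift_C1:
  assumes g: "bilinear_field (quotient_atlas p) g"
  shows "(\<lambda>y. lift g y u v) differentiable (at x)"
    and "continuous_on UNIV (\<lambda>y. frechet_derivative (\<lambda>y. lift g y u v) (at y) w)"
proof -
  have *: "(\<lambda>y. lift g y u v) differentiable (at x) \<and>
    isCont (\<lambda>y. frechet_derivative (\<lambda>y. lift g y u v) (at y) w) x" for x
  proof -
    obtain U where U: "open U" "x \<in> U" "inj_on p U" using locally_inj by blast
    let ?c = "(p ` U, inv_into U p)"
    have "?c \<in> quotient_atlas p" using U by (auto simp: quotient_atlas_def)
    then have "smooth_on U (\<lambda>y. g ?c y u v)"
      using g U(3) chart_image_eq by (fastforce simp: bilinear_field_def)
    then have "Ck_on (Suc 0) U (\<lambda>y. g ?c y u v)" by (simp only: smooth_on_def)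
    then have diff: "\<And>y. y \<in> U \<Longrightarrow> (\<lambda>y. g ?c y u v) differentiable (at y)"
      and cont: "continuous_on U (\<lambda>y. frechet_derivative (\<lambda>y. g ?c y u v) (at y) w)"
      by auto
    have deriv: "((\<lambda>y. lift g y u v) has_derivative frechet_derivative (\<lambda>y. g ?c y u v) (at y)) (at y)"
      if "y \<in> U" for y
      by (rule has_derivative_transform_within_open[OF iffD1[OF frechet_derivative_works diff[OF that]] U(1) that])
        (simp add: lift_eq[OF g U(1,3)])
    have "continuous_on U (\<lambda>y. frechet_derivative (\<lambda>y. lift g y u v) (at y) w)"
      using cont frechet_derivative_eqI[OF deriv] by (simp cong: continuous_on_cong)
    then show ?thesis
      using differentiableI[OF deriv[OF U(2)]] U(1,2) by (simp add: continuous_on_eq_continuous_at)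
  qed
  then show "(\<lambda>y. lift g y u v) differentiable (at x)"
    "continuous_on UNIV (\<lambda>y. frechet_derivative (\<lambda>y. lift g y u v) (at y) w)"
    by (auto intro: continuous_at_imp_continuous_on)
qed

end

section \<open>Periods of closed 2-forms\<close>

text \<open>Two nested averages integrate over a parallelogram, which is a torus when its sides are
  periods. As an operator on functions, it turns Fubini's theorem into a commutation rule.\<close>

definition seg_avg :: "'a::euclidean_space \<Rightarrow> ('a \<Rightarrow> real) \<Rightarrow> 'a \<Rightarrow> real" where
  "seg_avg u g x = integral {0..1} (\<lambda>s. g (x + s *\<^sub>R u))"

lemma continuous_on_comp_UNIV:
  "continuous_on UNIV g \<Longrightarrow> continuous_on S h \<Longrightarrow> continuous_on S (\<lambda>x. g (h x))"
  by (rule continuous_on_compose2) auto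

lemma seg_integrable:
  fixes g :: "'a::euclidean_space \<Rightarrow> real"
  assumes "continuous_on UNIV g"
  shows "(\<lambda>s. g (x + s *\<^sub>R u)) integrable_on {0..1::real}"
  by (rule integrable_continuous_real)
    (intro continuous_on_comp_UNIV[OF assms] continuous_intros)

lemma continuous_seg_avg:
  assumes "continuous_on UNIV g"
  shows "continuous_on UNIV (seg_avg u g)"
proof -
  have "continuous_on (UNIV \<times> cbox 0 1) (\<lambda>(x, s). g (x + s *\<^sub>R u))"
    unfolding split_beta by (intro continuous_on_comp_UNIV[OF assms] continuous_intros)
  then have "continuous_on UNIV (\<lambda>x. integral (cbox 0 1) (\<lambda>s. g (x + s *\<^sub>R u)))"
    by (rule integral_continuous_on_param)
  then show ?thesis by (simp add: seg_avg_def[abs_def])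
qed

text \<open>The integrand has the shape of closedness of a 2-form, solved for one of the three
  derivatives.\<close>

lemma seg_avg_minus_sum:
  assumes "continuous_on UNIV f" "continuous_on UNIV g"
  shows "seg_avg u (\<lambda>y. - f y - g y) = (\<lambda>y. - seg_avg u f y - seg_avg u g y)"
proof
  fix x
  have "(\<lambda>s. - f (x + s *\<^sub>R u)) integrable_on {0..1::real}"
    using seg_integrable[OF assms(1)] by (rule integrable_neg)
  from integral_diff[OF this seg_integrable[OF assms(2)]]
  show "seg_avg u (\<lambda>y. - f y - g y) x = - seg_avg u f x - seg_avg u g x"
    by (simp add: seg_avg_def)
qed

lemma seg_avg_diff_shift:
  assumes "continuous_on UNIV f"
  shows "seg_avg u (\<lambda>y. f (y + e) - f y) = (\<lambda>y. seg_avg u f (y + e) - seg_avg u f y)"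
proof
  fix x
  from integral_diff[OF seg_integrable[OF assms, of "x + e" u] seg_integrable[OF assms, of x u]]
  show "seg_avg u (\<lambda>y. f (y + e) - f y) x = seg_avg u f (x + e) - seg_avg u f x"
    by (simp add: seg_avg_def add_ac)
qed

lemma seg_avg_commute:
  assumes "continuous_on UNIV g"
  shows "seg_avg u (seg_avg v g) = seg_avg v (seg_avg u g)"
proof
  fix x
  have "continuous_on (cbox (0, 0) (1, 1)) (\<lambda>(s, t). g (x + s *\<^sub>R u + t *\<^sub>R v))"
    unfolding split_beta by (intro continuous_on_comp_UNIV[OF assms] continuous_intros)
  from integral_swap_continuous[OF this] show "seg_avg u (seg_avg v g) x = seg_avg v (seg_avg u g) x"
    by (simp add: seg_avg_def[abs_def] algebra_simps)
qed

lemma seg_avg_ge: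
  assumes "continuous_on UNIV g" "\<And>s. K \<le> g (x + s *\<^sub>R u)"
  shows "K \<le> seg_avg u g x"
proof -
  have "integral {0..1::real} (\<lambda>s. K) \<le> seg_avg u g x"
    unfolding seg_avg_def by (intro integral_le seg_integrable assms) auto
  then show ?thesis by simp
qed

text \<open>The fundamental theorem of calculus along the segment from \<open>x\<close> to
  \<open>x + u\<close>.\<close>

lemma seg_avg_derivative:
  assumes "\<And>y. f differentiable (at y)"
  shows "seg_avg u (\<lambda>y. frechet_derivative f (at y) u) x = f (x + u) - f x"
proof -
  have "((\<lambda>s. f (x + s *\<^sub>R u)) has_vector_derivative frechet_derivative f (at (x + s *\<^sub>R u)) u)
    (at s within {0..1})" for s
  proof -
    have f: "(f has_derivative frechet_derivative f (at (x + s *\<^sub>R u)))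
      (at (x + s *\<^sub>R u))"
      using assms frechet_derivative_works by blast
    have "((\<lambda>s. x + s *\<^sub>R u) has_derivative (\<lambda>h. h *\<^sub>R u)) (at s within {0..1})"
      by (auto intro!: derivative_eq_intros)
    from diff_chain_within[OF this has_derivative_at_withinI[OF f]]
    show ?thesis
      unfolding has_vector_derivative_def
      by (simp add: comp_def linear_cmul[OF linear_frechet_derivative[OF assms]])
  qed
  then have "((\<lambda>s. frechet_derivative f (at (x + s *\<^sub>R u)) u) has_integral
      (f (x + 1 *\<^sub>R u) - f (x + 0 *\<^sub>R u))) {0..1}"
    by (intro fundamental_theorem_of_calculus) auto
  then show ?thesis
    unfolding seg_avg_def by (auto dest: integral_unique)
qed

text \<open>The integral of a closed form over the torus spanned by two periods \<open>u\<close> and \<open>v\<close> does not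
  depend on the base point: by closedness its derivative in the direction \<open>e\<close> is the integral
  of derivatives in the directions \<open>u\<close> and \<open>v\<close>, which vanish by periodicity.\<close>
lemma closed_form_period_const:
  fixes \<omega> :: "'a::euclidean_space \<Rightarrow> 'a \<Rightarrow> 'a \<Rightarrow> real"
  assumes diff: "\<And>a b y. (\<lambda>y. \<omega> y a b) differentiable (at y)"
    and cont: "\<And>a b c. continuous_on UNIV (\<lambda>y. frechet_derivative (\<lambda>y. \<omega> y a b) (at y) c)"
    and closed: "\<And>y a b c. frechet_derivative (\<lambda>y. \<omega> y b c) (at y) a +
      frechet_derivative (\<lambda>y. \<omega> y c a) (at y) b + frechet_derivative (\<lambda>y. \<omega> y a b) (at y) c = 0"
    and period_u: "\<And>y a b. \<omega> (y + u) a b = \<omega> y a b"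
    and period_v: "\<And>y a b. \<omega> (y + v) a b = \<omega> y a b"
  shows "seg_avg u (seg_avg v (\<lambda>y. \<omega> y u v)) (x + e) = seg_avg u (seg_avg v (\<lambda>y. \<omega> y u v)) x"
proof -
  define D where "D a b c y = frechet_derivative (\<lambda>y. \<omega> y a b) (at y) c" for a b c y
  have cD [simp]: "continuous_on UNIV (D a b c)" for a b c
    using cont by (simp add: D_def[abs_def])
  have c\<omega> [simp]: "continuous_on UNIV (\<lambda>y. \<omega> y a b)" for a b
    using diff by (intro continuous_at_imp_continuous_on ballI differentiable_imp_continuous_within)
  have ftc: "seg_avg c (D a b c) = (\<lambda>y. \<omega> (y + c) a b - \<omega> y a b)" for a b c
    using seg_avg_derivative[OF diff] by (simp add: D_def[abs_def] fun_eq_iff)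
  have zero: "seg_avg c (\<lambda>y. 0) = (\<lambda>y. 0)" for c :: 'a
    by (simp add: seg_avg_def[abs_def])
  have D_eq: "D u v e = (\<lambda>y. - D v e u y - D e u v y)"
  proof
    fix y show "D u v e y = - D v e u y - D e u v y"
      using closed[where a = e and b = u and c = v and y = y] by (simp add: D_def)
  qed
  \<comment> \<open>Fubini brings the average along \<open>u\<close> innermost, where it meets a
    derivative along \<open>u\<close> and yields a difference across a period.\<close>
  have 1: "seg_avg u (seg_avg v (seg_avg e (D v e u))) = (\<lambda>y. 0)"
  proof -
    have "seg_avg u (seg_avg v (seg_avg e (D v e u))) = seg_avg v (seg_avg u (seg_avg e (D v e u)))"
      by (simp add: seg_avg_commute continuous_seg_avg)
    also have "\<dots> = seg_avg v (seg_avg e (seg_avg u (D v e u)))"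
      by (subst seg_avg_commute[of _ u e]) simp_all
    finally show ?thesis by (simp add: ftc period_u zero)
  qed
  have 2: "seg_avg u (seg_avg v (seg_avg e (D e u v))) = (\<lambda>y. 0)"
  proof -
    have "seg_avg u (seg_avg v (seg_avg e (D e u v))) = seg_avg u (seg_avg e (seg_avg v (D e u v)))"
      by (subst seg_avg_commute[of _ v e]) simp_all
    then show ?thesis by (simp add: ftc period_v zero)
  qed
  \<comment> \<open>The third average, along \<open>e\<close>, integrates the derivative along
    \<open>e\<close> to the difference between base points \<open>y + e\<close> and
    \<open>y\<close>; \<open>e\<close> itself may be any vector.\<close>
  have "seg_avg u (seg_avg v (seg_avg e (D u v e))) =
      (\<lambda>y. - seg_avg u (seg_avg v (seg_avg e (D v e u))) y
        - seg_avg u (seg_avg v (seg_avg e (D e u v))) y)"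
    unfolding D_eq by (simp add: seg_avg_minus_sum continuous_seg_avg)
  then have "seg_avg u (seg_avg v (\<lambda>y. \<omega> (y + e) u v - \<omega> y u v)) x = 0"
    by (simp add: 1 2 ftc)
  then show ?thesis
    by (simp add: seg_avg_diff_shift[OF c\<omega>] seg_avg_diff_shift[OF continuous_seg_avg[OF c\<omega>]])
qed

text \<open>The quadratic form attains a positive minimum on the compact product of \<open>C\<close>
  with the unit sphere; homogeneity extends the bound to all vectors.\<close>

lemma uniformly_positive:
  fixes g :: "'a::euclidean_space \<Rightarrow> 'b::euclidean_space \<Rightarrow> 'b \<Rightarrow> real"
  assumes cont: "\<And>u v. continuous_on C (\<lambda>x. g x u v)"
    and bil: "\<And>x. x \<in> C \<Longrightarrow> bilinear (g x)"
    and pos: "\<And>x u. x \<in> C \<Longrightarrow> u \<noteq> 0 \<Longrightarrow> 0 < g x u u"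
    and "compact C"
  obtains c where "c > 0" "\<And>x u. x \<in> C \<Longrightarrow> c * (norm u)\<^sup>2 \<le> g x u u"
proof -
  define q where "q = (\<lambda>z. g (fst z) (snd z) (snd z))"
  \<comment> \<open>Continuity is assumed only for fixed vectors; expansion in a basis makes it
    joint in the point and the vector.\<close>
  have q_eq: "q z = (\<Sum>i\<in>Basis. \<Sum>j\<in>Basis. (snd z \<bullet> i) * (snd z \<bullet> j) * g (fst z) i j)"
    if "z \<in> C \<times> sphere 0 1" for z
  proof -
    from that have b: "bilinear (g (fst z))" using bil by auto
    have "q z = g (fst z) (\<Sum>i\<in>Basis. (snd z \<bullet> i) *\<^sub>R i) (\<Sum>j\<in>Basis. (snd z \<bullet> j) *\<^sub>R j)"
      by (simp add: q_def euclidean_representation)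
    also have "\<dots> = (\<Sum>(i, j)\<in>Basis \<times> Basis. g (fst z) ((snd z \<bullet> i) *\<^sub>R i) ((snd z \<bullet> j) *\<^sub>R j))"
      by (rule bilinear_sum[OF b])
    finally show ?thesis
      by (simp add: sum.cartesian_product split_beta bilinear_lmul[OF b] bilinear_rmul[OF b] mult_ac)
  qed
  have "continuous_on (C \<times> sphere 0 1) (\<lambda>z. g (fst z) i j)" for i j
    by (rule continuous_on_compose2[OF cont]) (auto intro!: continuous_intros)
  then have "continuous_on (C \<times> sphere 0 1)
      (\<lambda>z. \<Sum>i\<in>Basis. \<Sum>j\<in>Basis. (snd z \<bullet> i) * (snd z \<bullet> j) * g (fst z) i j)"
    by (intro continuous_intros)
  then have cq: "continuous_on (C \<times> sphere 0 1) q"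
    using q_eq by (simp cong: continuous_on_cong)
  have "\<exists>c>0. \<forall>z\<in>C \<times> sphere 0 1. c \<le> q z"
  proof (cases "C \<times> sphere (0::'b) 1 = {}")
    case False
    obtain z where z: "z \<in> C \<times> sphere 0 1" "\<And>y. y \<in> C \<times> sphere 0 1 \<Longrightarrow> q z \<le> q y"
      using continuous_attains_inf[OF compact_Times[OF \<open>compact C\<close> compact_sphere] False cq] by blast
    have "0 < q z" unfolding q_def using z(1) by (intro pos) auto
    with z(2) show ?thesis by blast
  qed (auto intro: exI[of _ 1])
  then obtain c where c: "c > 0" "\<And>x u. x \<in> C \<Longrightarrow> norm u = 1 \<Longrightarrow> c \<le> g x u u"
    by (auto simp: q_def)
  show ?thesis
  proof (rule that[OF c(1)])
    fix x and u :: 'b assume x: "x \<in> C"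
    show "c * (norm u)\<^sup>2 \<le> g x u u"
    proof (cases "u = 0")
      case True
      then show ?thesis using bilinear_lzero[OF bil[OF x]] by simp
    next
      case False
      have "g x u u = g x (norm u *\<^sub>R sgn u) (norm u *\<^sub>R sgn u)"
        using False by (simp add: sgn_div_norm)
      also have "\<dots> = (norm u)\<^sup>2 * g x (sgn u) (sgn u)"
        by (simp only: bilinear_lmul[OF bil[OF x]] bilinear_rmul[OF bil[OF x]])
          (simp add: power2_eq_square)
      finally show ?thesis
        using c(2)[OF x, of "sgn u"] False
        by (simp add: norm_sgn mult.commute mult_left_mono)
    qed
  qed
qed

section \<open>The universal cover of the suspension\<close>

lemma mem_torus_class: "y \<in> torus_class v \<longleftrightarrow> y - v \<in> lattice8"
  by (simp add: torus_class_def lattice8_def)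

lemma torus_class_eq_iff: "torus_class v = torus_class w \<longleftrightarrow> w - v \<in> lattice8"
proof
  assume "torus_class v = torus_class w"
  moreover have "w \<in> torus_class w" by (simp add: mem_torus_class lattice8_0)
  ultimately show "w - v \<in> lattice8" by (simp flip: mem_torus_class)
next
  assume *: "w - v \<in> lattice8"
  have "y - v \<in> lattice8 \<longleftrightarrow> y - w \<in> lattice8" for y
    using lattice8_add[OF _ *, of "y - w"] lattice8_diff[OF _ *, of "y - v"] by auto
  then show "torus_class v = torus_class w" by (auto simp: mem_torus_class)
qed

lemma topspace_torus8: "topspace torus8 = range torus_class"
  by (simp add: torus8_def topspace_quotient_topology)

text \<open>The image fills the whole coset because \<open>A8_inv\<close> preserves the lattice
  too.\<close>

lemma f_A_torus_class: "f_A (torus_class v) = torus_class (A8 v)"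
proof
  show "f_A (torus_class v) \<subseteq> torus_class (A8 v)"
    using lattice8_A8 by (force simp: f_A_eq mem_torus_class simp flip: linear_diff[OF linear_A8])
  show "torus_class (A8 v) \<subseteq> f_A (torus_class v)"
  proof
    fix y assume "y \<in> torus_class (A8 v)"
    then have "A8_inv y \<in> torus_class v"
      using lattice8_A8_inv[of "y - A8 v"] by (simp add: mem_torus_class linear_diff[OF linear_A8_inv])
    then show "y \<in> f_A (torus_class v)" unfolding f_A_eq by (metis A8_A8_inv imageI)
  qed
qed

text \<open>The saturation of \<open>U\<close> is the union of its lattice translates.\<close>

lemma openin_torus_class:
  assumes "open U"
  shows "openin torus8 (torus_class ` U)"
proof -
  have "{x. torus_class x \<in> torus_class ` U} = (\<Union>k\<in>lattice8. (\<lambda>x. x + k) ` U)" (is "?L = ?R")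
  proof
    show "?L \<subseteq> ?R"
    proof
      fix x assume "x \<in> ?L"
      then obtain u where "u \<in> U" "x - u \<in> lattice8" by (auto simp: torus_class_eq_iff[symmetric])
      then show "x \<in> ?R" by (intro UN_I[of "x - u"]) (auto intro!: image_eqI[of _ _ u])
    qed
    show "?R \<subseteq> ?L"
    proof
      fix x assume "x \<in> ?R"
      then obtain k u where "k \<in> lattice8" "u \<in> U" "x = u + k" by auto
      then have "torus_class x = torus_class u" by (simp add: torus_class_eq_iff lattice8_minus)
      with \<open>u \<in> U\<close> show "x \<in> ?L" by simp
    qed
  qed
  moreover have "open ?R" using assms open_translation[of U] by (intro open_UN ballI) (simp add: add.commute)
  ultimately show ?thesis by (auto simp: torus8_def openin_quotient_topology)
qed

text \<open>Factors through the product of the torus with \<real>^4. A product of a quotient map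
  with an identity need not be a quotient map in general; openness of the torus projection ensures
  it here.\<close>

lemma quotient_map_cover_S: "quotient_map euclidean S_A cover_S"
proof -
  let ?q = "\<lambda>z :: E12. (torus_class (fst z), snd z)"
  have "continuous_map euclidean torus8 torus_class"
    unfolding torus8_def by (rule quotient_imp_continuous_map[OF quotient_map_quotient_topology])
  then have "continuous_map euclidean (prod_topology torus8 euclidean) ?q"
    unfolding continuous_map_pairwise comp_def
    by (auto simp: continuous_map_iff_continuous2 intro!: continuous_intros
        continuous_map_compose[where g = torus_class and f = fst, unfolded comp_def])
  moreover have "open_map euclidean (prod_topology torus8 euclidean) ?q"
    unfolding open_map_def
  proof (intro allI impI)
    fix W :: "E12 set" assume "openin euclidean W"
    then have W: "open W" by simp
    show "openin (prod_topology torus8 euclidean) (?q ` W)"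
      unfolding openin_prod_topology_alt
    proof (intro allI impI)
      fix P x assume "(P, x) \<in> ?q ` W"
      then obtain v where v: "P = torus_class v" "(v, x) \<in> W" by auto
      obtain A B where AB: "open A" "open B" "(v, x) \<in> A \<times> B" "A \<times> B \<subseteq> W"
        using open_prod_elim[OF W v(2)] by blast
      have "torus_class ` A \<times> B \<subseteq> ?q ` W"
        using AB(4) by (force intro: image_eqI)
      with AB v(1) show "\<exists>U V. openin torus8 U \<and> openin euclidean V \<and> P \<in> U \<and> x \<in> V \<and> U \<times> V \<subseteq> ?q ` W"
        by (intro exI[of _ "torus_class ` A"] exI[of _ B]) (auto simp: openin_torus_class)
    qed
  qed
  moreover have "?q ` UNIV = topspace (prod_topology torus8 euclidean)"
    by (auto simp: topspace_torus8 image_def)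
  ultimately have "quotient_map euclidean (prod_topology torus8 euclidean) ?q"
    by (intro continuous_open_imp_quotient_map) auto
  moreover have "quotient_map (prod_topology torus8 euclidean) S_A (suspension_proj torus8 susp_maps)"
    unfolding S_A_def suspension_def by (rule quotient_map_quotient_topology)
  ultimately have "quotient_map euclidean S_A (suspension_proj torus8 susp_maps \<circ> ?q)"
    by (rule quotient_map_compose)
  moreover have "suspension_proj torus8 susp_maps \<circ> ?q = cover_S"
    by (auto simp: cover_S_def)
  ultimately show ?thesis by simp
qed

section \<open>The orbit relation of the suspension in coordinates\<close>

abbreviation step_S :: "(((real^8) set \<times> (real^4)) \<times> ((real^8) set \<times> (real^4))) set" where
  "step_S \<equiv> suspension_step torus8 susp_maps \<union> (suspension_step torus8 susp_maps)\<inverse>"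

lemma cover_S_eq_iff_step: "cover_S (v, x) = cover_S (w, y) \<longleftrightarrow> ((torus_class v, x), (torus_class w, y)) \<in> step_S\<^sup>*"
proof -
  have "sym (step_S\<^sup>*)" by (intro sym_rtrancl sym_Un_converse)
  then show ?thesis
    unfolding cover_S_def suspension_proj_def split_conv
    by (auto simp: Image_singleton set_eq_iff dest: symD intro: rtrancl_trans)
qed

lemma step_S_forward:
  "((torus_class v, x), (torus_class (if i = 1 then A8 v else v), x + axis i 1)) \<in> step_S"
  by (auto simp: suspension_step_def susp_maps_def f_A_torus_class topspace_torus8)

lemma step_S_pow:
  "((torus_class v, x), (torus_class (if i = 1 then A8_pow n v else v), x + of_int n *\<^sub>R axis i 1)) \<in> step_S\<^sup>*"
proof (induction n rule: int_induct[of _ 0])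
  case base
  show ?case by simp
next
  case (step1 n)
  have "((torus_class (if i = 1 then A8_pow n v else v), x + of_int n *\<^sub>R axis i 1),
    (torus_class (if i = 1 then A8_pow (n + 1) v else v), x + of_int (n + 1) *\<^sub>R axis i 1)) \<in> step_S"
    using step_S_forward[of "if i = 1 then A8_pow n v else v" "x + of_int n *\<^sub>R axis i 1" i]
    by (auto simp: A8_A8_pow scaleR_left_distrib add.assoc split: if_splits)
  with step1 show ?case by (rule_tac rtrancl_into_rtrancl)
next
  case (step2 n)
  have "((torus_class (if i = 1 then A8_pow (n - 1) v else v), x + of_int (n - 1) *\<^sub>R axis i 1),
     (torus_class (if i = 1 then A8_pow n v else v), x + of_int n *\<^sub>R axis i 1)) \<in> step_S"
    using step_S_forward[of "if i = 1 then A8_pow (n - 1) v else v" "x + of_int (n - 1) *\<^sub>R axis i 1" i]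
    by (auto simp: A8_A8_pow scaleR_left_diff_distrib add.assoc split: if_splits)
  then have "((torus_class (if i = 1 then A8_pow n v else v), x + of_int n *\<^sub>R axis i 1),
    (torus_class (if i = 1 then A8_pow (n - 1) v else v), x + of_int (n - 1) *\<^sub>R axis i 1)) \<in> step_S"
    by blast
  with step2 show ?case by (rule_tac rtrancl_into_rtrancl)
qed

text \<open>The integer \<open>n\<close> counts the net uses of the first generator. It is at once
  the exponent of the automorphism and the shift of the first coordinate, which ties the two
  together along any chain of steps.\<close>

lemma step_S_invariant:
  assumes "((torus_class v, x), Q) \<in> step_S\<^sup>*"
  shows "\<exists>w y n. Q = (torus_class w, y) \<and> (\<forall>i. y $ i - x $ i \<in> \<int>) \<and> y $ 1 - x $ 1 = of_int n \<and>
    w - A8_pow n v \<in> lattice8"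
  using assms
proof (induction rule: rtrancl_induct)
  case base
  show ?case by (intro exI[of _ v] exI[of _ x] exI[of _ 0]) (simp add: lattice8_0)
next
  case (step Q R)
  then obtain w y n where Q: "Q = (torus_class w, y)" "\<forall>i. y $ i - x $ i \<in> \<int>"
    "y $ 1 - x $ 1 = of_int n" "w - A8_pow n v \<in> lattice8" by blast
  from step.hyps(2) show ?case
  proof
    assume "(Q, R) \<in> suspension_step torus8 susp_maps"
    then obtain i where R: "R = (susp_maps i (torus_class w), y + axis i 1)"
      unfolding suspension_step_def Q(1) by blast
    have int: "\<forall>j. (y + axis i 1) $ j - x $ j \<in> \<int>"
    proof
      fix j
      have "(y + axis i 1) $ j - x $ j = (y $ j - x $ j) + axis i 1 $ j" by simp
      moreover have "axis i 1 $ j \<in> (\<int> :: real set)" by (simp add: axis_def)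
      ultimately show "(y + axis i 1) $ j - x $ j \<in> \<int>" using Q(2) by (metis Ints_add)
    qed
    show ?case
    proof (cases "i = 1")
      case True
      have "A8 w - A8_pow (n + 1) v \<in> lattice8"
        using lattice8_A8[OF Q(4)] by (simp add: linear_diff[OF linear_A8] A8_A8_pow)
      with True int Q(3) show ?thesis
        by (intro exI[of _ "A8 w"] exI[of _ "y + axis i 1"] exI[of _ "n + 1"])
          (simp add: R susp_maps_def f_A_torus_class)
    next
      case False
      with int Q(3,4) show ?thesis
        by (intro exI[of _ w] exI[of _ "y + axis i 1"] exI[of _ n])
          (simp add: R susp_maps_def axis_def)
    qed
  next
    assume "(Q, R) \<in> (suspension_step torus8 susp_maps)\<inverse>"
    then obtain i u z where R: "R = (torus_class u, z)" "torus_class w = susp_maps i (torus_class u)"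
      "y = z + axis i 1"
      unfolding suspension_step_def Q(1) topspace_torus8 by blast
    have int: "\<forall>j. z $ j - x $ j \<in> \<int>"
    proof
      fix j
      have "z $ j - x $ j = (y $ j - x $ j) - axis i 1 $ j" by (simp add: R(3))
      moreover have "axis i 1 $ j \<in> (\<int> :: real set)" by (simp add: axis_def)
      ultimately show "z $ j - x $ j \<in> \<int>" using Q(2) by (metis Ints_diff)
    qed
    show ?case
    proof (cases "i = 1")
      case True
      with R(2) have "A8 u - w \<in> lattice8"
        by (simp add: susp_maps_def f_A_torus_class torus_class_eq_iff)
      from lattice8_A8_inv[OF lattice8_add[OF this Q(4)]] have "u - A8_pow (n - 1) v \<in> lattice8"
        by (simp add: linear_diff[OF linear_A8_inv] A8_inv_A8_pow)
      with True int Q(3) show ?thesis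
        by (intro exI[of _ u] exI[of _ z] exI[of _ "n - 1"]) (simp add: R)
    next
      case False
      then have "u - w \<in> lattice8" using R(2) by (simp add: susp_maps_def torus_class_eq_iff)
      from lattice8_add[OF this Q(4)] False int Q(3) show ?thesis
        by (intro exI[of _ u] exI[of _ z] exI[of _ n]) (simp add: R axis_def)
    qed
  qed
qed

text \<open>Explicit form of the deck group. One direction is \<open>step_S_invariant\<close>; for
  the other, the four real coordinates are moved one after another.\<close>

lemma cover_S_eq_iff:
  "cover_S (v, x) = cover_S (w, y) \<longleftrightarrow>
    (\<exists>n. y $ 1 - x $ 1 = of_int n \<and> w - A8_pow n v \<in> lattice8) \<and> (\<forall>i. y $ i - x $ i \<in> \<int>)"
    (is "?L \<longleftrightarrow> ?R")
proof
  assume ?L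
  then obtain w' y' n where *: "(torus_class w, y) = (torus_class w', y')" "\<forall>i. y' $ i - x $ i \<in> \<int>"
    "y' $ 1 - x $ 1 = of_int n" "w' - A8_pow n v \<in> lattice8"
    unfolding cover_S_eq_iff_step by (blast dest: step_S_invariant)
  then have "w - w' \<in> lattice8" by (metis torus_class_eq_iff prod.inject)
  from lattice8_add[OF this *(4)] * show ?R by auto
next
  assume ?R
  then obtain n where n: "y $ 1 - x $ 1 = of_int n" "w - A8_pow n v \<in> lattice8" by blast
  have "\<forall>i. \<exists>m. y $ i - x $ i = of_int m" using \<open>?R\<close> by (auto elim: Ints_cases)
  then obtain m where m: "y $ i - x $ i = of_int (m i)" for i by metis
  let ?x = "\<lambda>i. of_int (m i) *\<^sub>R (axis i 1 :: real^4)"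
  let ?V = "torus_class (A8_pow n v)"
  \<comment> \<open>Here \<open>m 1 = n\<close>, so the first generator also brings the torus point
    to its final class; the other three leave it fixed.\<close>
  have "((torus_class v, x), (?V, x + ?x 1)) \<in> step_S\<^sup>*"
    using step_S_pow[of v x 1 "m 1"] n(1) m[of 1] by simp
  also have "((?V, x + ?x 1), (?V, x + ?x 1 + ?x 2)) \<in> step_S\<^sup>*"
    using step_S_pow[of "A8_pow n v" _ 2] by simp
  also have "((?V, x + ?x 1 + ?x 2), (?V, x + ?x 1 + ?x 2 + ?x 3)) \<in> step_S\<^sup>*"
    using step_S_pow[of "A8_pow n v" _ 3] by simp
  also have "((?V, x + ?x 1 + ?x 2 + ?x 3), (?V, x + ?x 1 + ?x 2 + ?x 3 + ?x 4)) \<in> step_S\<^sup>*"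
    using step_S_pow[of "A8_pow n v" _ 4] by simp
  also have "x + ?x 1 + ?x 2 + ?x 3 + ?x 4 = y"
    by (simp add: vec_eq_iff forall_4 axis_def m[symmetric])
  also have "?V = torus_class w" using n(2) by (simp add: torus_class_eq_iff)
  finally show ?L by (simp add: cover_S_eq_iff_step)
qed

definition holonomy_S :: "(E12 \<Rightarrow> E12) set" where
  "holonomy_S = range (\<lambda>n. map_prod (A8_pow n) id)"

text \<open>Along a convergent sequence of related pairs the exponents are convergent integers,
  hence eventually a constant \<open>N\<close>. The limit then satisfies the relation by continuity
  of \<open>A8_pow N\<close> and closedness of the lattice.\<close>

lemma closed_cover_S_rel: "closed {(q, r). cover_S q = cover_S r}"
  unfolding closed_sequential_limits
proof (intro allI impI)
  fix f :: "nat \<Rightarrow> E12 \<times> E12" and l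
  assume "(\<forall>j. f j \<in> {(q, r). cover_S q = cover_S r}) \<and> f \<longlonglongrightarrow> l"
  then have f: "\<And>j. cover_S (fst (f j)) = cover_S (snd (f j))" and lim: "f \<longlonglongrightarrow> l"
    by (auto simp: split_beta)
  define v x w y where "v j = fst (fst (f j))" and "x j = snd (fst (f j))"
    and "w j = fst (snd (f j))" and "y j = snd (snd (f j))" for j
  define v' x' w' y' where "v' = fst (fst l)" and "x' = snd (fst l)"
    and "w' = fst (snd l)" and "y' = snd (snd l)"
  note defs = v_def x_def w_def y_def v'_def x'_def w'_def y'_def
  have lims: "v \<longlonglongrightarrow> v'" "x \<longlonglongrightarrow> x'" "w \<longlonglongrightarrow> w'" "y \<longlonglongrightarrow> y'"
    unfolding defs by (intro tendsto_fst tendsto_snd lim)+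
  have "cover_S (v j, x j) = cover_S (w j, y j)" for j using f by (simp add: defs)
  then have "\<exists>n. y j $ 1 - x j $ 1 = of_int n \<and> w j - A8_pow n (v j) \<in> lattice8"
    and int: "y j $ i - x j $ i \<in> \<int>" for i j
    unfolding cover_S_eq_iff by blast+
  then obtain n where n: "\<And>j. y j $ 1 - x j $ 1 = of_int (n j)"
    "\<And>j. w j - A8_pow (n j) (v j) \<in> lattice8" by metis
  have lim_i: "(\<lambda>j. y j $ i - x j $ i) \<longlonglongrightarrow> y' $ i - x' $ i" for i
    by (intro tendsto_intros lims)
  have int': "y' $ i - x' $ i \<in> \<int>" for i
    by (rule closed_sequentially[OF closed_Ints int lim_i])
  then obtain N where N: "y' $ 1 - x' $ 1 = of_int N" by (metis Ints_cases)
  have "\<forall>\<^sub>F j in sequentially. dist (y j $ 1 - x j $ 1) (of_int N) < 1"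
    using tendstoD[OF lim_i[of 1], of 1] N by simp
  then have ev: "\<forall>\<^sub>F j in sequentially. n j = N"
    by eventually_elim (simp add: n(1) dist_real_def flip: of_int_diff of_int_abs)
  have "(\<lambda>j. w j - A8_pow N (v j)) \<longlonglongrightarrow> w' - A8_pow N v'"
    by (intro tendsto_diff lims bounded_linear.tendsto[OF iffD1[OF linear_conv_bounded_linear linear_A8_pow]])
  moreover have "\<forall>\<^sub>F j in sequentially. w j - A8_pow N (v j) \<in> lattice8"
    using ev by eventually_elim (use n(2) in metis)
  ultimately have "w' - A8_pow N v' \<in> lattice8"
    by (intro Lim_in_closed_set[OF closed_lattice8]) auto
  then have "cover_S (v', x') = cover_S (w', y')"
    unfolding cover_S_eq_iff using N int' by blast
  then show "l \<in> {(q, r). cover_S q = cover_S r}" by (simp add: defs split_beta)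
qed

text \<open>Two points of the ball are at distance less than 1. Integrality first makes the
  \<real>^4 parts equal, which forces the exponent 0, and then makes the \<real>^8 parts
  equal.\<close>

lemma inj_on_cover_S: "inj_on cover_S (ball q (1 / 2))"
proof (rule inj_onI)
  fix a b assume ab: "a \<in> ball q (1 / 2)" "b \<in> ball q (1 / 2)" and eq: "cover_S a = cover_S b"
  obtain v x w y where vw: "a = (v, x)" "b = (w, y)" by (metis surj_pair)
  have "dist a b < 1" using ab dist_triangle_half_r[of q a 1 b] by (simp add: dist_commute)
  then have d: "norm (w - v) < 1" "norm (y - x) < 1"
    using dist_fst_le[of b a] dist_snd_le[of b a]
    by (simp_all only: vw fst_conv snd_conv dist_norm[symmetric] dist_commute[of "(v, x)"])
  have zero: "r = 0" if "r \<in> \<int>" "\<bar>r\<bar> < 1" for r :: real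
    using that by (metis Ints_nonzero_abs_less1)
  from eq obtain n where n: "y $ 1 - x $ 1 = of_int n" "w - A8_pow n v \<in> lattice8"
    and int: "\<And>i. y $ i - x $ i \<in> \<int>" unfolding vw cover_S_eq_iff by blast
  have xy: "y $ i - x $ i = 0" for i
    using component_le_norm_cart[of "y - x" i] d(2) by (intro zero int) simp
  with n(1) have "n = 0" by simp
  with n(2) have "w - v \<in> lattice8" by simp
  then have "w $ i - v $ i = 0" for i
    using component_le_norm_cart[of "w - v" i] d(1) by (intro zero) (auto simp: lattice8_def)
  with xy show "a = b" by (simp add: vw vec_eq_iff)
qed

interpretation S: affine_cover cover_S S_A holonomy_S
proof (rule affine_cover.intro)
  show "quotient_map euclidean S_A cover_S" by (rule quotient_map_cover_S)
  show "closed {(q, r). cover_S q = cover_S r}" by (rule closed_cover_S_rel)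
  fix q r :: E12
  show "\<exists>U. open U \<and> q \<in> U \<and> inj_on cover_S U"
    using inj_on_cover_S by (intro exI[of _ "ball q (1 / 2)"]) auto
  assume eq: "cover_S q = cover_S r"
  obtain v x w y where vw: "q = (v, x)" "r = (w, y)" by (metis surj_pair)
  have int: "\<forall>i. y $ i - x $ i \<in> \<int>"
    and "\<exists>n. y $ 1 - x $ 1 = of_int n \<and> w - A8_pow n v \<in> lattice8"
    using eq by (simp_all add: vw cover_S_eq_iff)
  then obtain n where n: "y $ 1 - x $ 1 = of_int n" "w - A8_pow n v \<in> lattice8" by blast
  have "cover_S (map_prod (A8_pow n) id z + (w - A8_pow n v, y - x)) = cover_S z" for z
  proof -
    have "cover_S z = cover_S (map_prod (A8_pow n) id z + (w - A8_pow n v, y - x))"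
      using n int by (cases z) (auto simp: cover_S_eq_iff)
    then show ?thesis by simp
  qed
  moreover have "r = map_prod (A8_pow n) id q + (w - A8_pow n v, y - x)" by (simp add: vw)
  ultimately show "\<exists>L\<in>holonomy_S. \<exists>a. r = L q + a \<and> (\<forall>z. cover_S (L z + a) = cover_S z)"
    unfolding holonomy_S_def by blast
next
  fix L assume "L \<in> holonomy_S"
  then show "linear L"
    by (auto simp: holonomy_S_def linear_iff linear_add[OF linear_A8_pow] linear_cmul[OF linear_A8_pow])
qed

section \<open>The structures on the suspension\<close>

definition I12 :: "E12 \<Rightarrow> E12" where "I12 = map_prod I8 I4"

definition J12 :: "E12 \<Rightarrow> E12" where "J12 = map_prod J8 J4"

definition h12 :: "E12 \<Rightarrow> E12 \<Rightarrow> real" where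
  "h12 u v = h8 (fst u) (fst v) + snd u \<bullet> snd v"

lemma I_S_eq: "I_S = (\<lambda>_ _. I12)"
  by (simp add: fun_eq_iff I_S_def I12_def)

lemma J_S_eq: "J_S = (\<lambda>_ _. J12)"
  by (simp add: fun_eq_iff J_S_def J12_def)

lemma K_S_eq: "K_S = (\<lambda>_ _. I12 \<circ> J12)"
  by (simp add: fun_eq_iff K_S_def I_S_eq J_S_eq)

lemma h_S_eq: "h_S = (\<lambda>_ _. h12)"
  by (simp add: fun_eq_iff h_S_def h12_def)

lemma I4_nth: "I4 x $ 1 = - x $ 2" "I4 x $ 2 = x $ 1" "I4 x $ 3 = - x $ 4" "I4 x $ 4 = x $ 3"
  by (simp_all add: I4_def axis_def)

lemma J4_nth: "J4 x $ 1 = - x $ 3" "J4 x $ 2 = x $ 4" "J4 x $ 3 = x $ 1" "J4 x $ 4 = - x $ 2"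
  by (simp_all add: J4_def axis_def)

lemma linear_I12: "linear I12"
  by (rule linearI) (auto simp: I12_def vec_eq_iff forall_8 forall_4 I8_nth I4_nth)

lemma linear_J12: "linear J12"
  by (rule linearI) (auto simp: J12_def vec_eq_iff forall_8 forall_4 J8_nth J4_nth)

lemma I12_I12 [simp]: "I12 (I12 v) = - v"
  by (cases v) (simp add: I12_def vec_eq_iff forall_8 forall_4 I8_nth I4_nth)

lemma J12_J12 [simp]: "J12 (J12 v) = - v"
  by (cases v) (simp add: J12_def vec_eq_iff forall_8 forall_4 J8_nth J4_nth)

lemma J12_I12: "J12 (I12 v) = - I12 (J12 v)"
  by (cases v) (simp add: I12_def J12_def vec_eq_iff forall_8 forall_4 J8_nth J4_nth I8_nth I4_nth)

lemma I12_minus: "I12 (- v) = - I12 v"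
  by (rule linear_neg[OF linear_I12])

lemma J12_minus: "J12 (- v) = - J12 v"
  by (rule linear_neg[OF linear_J12])

lemma I12_holonomy: "L \<in> holonomy_S \<Longrightarrow> I12 (L v) = L (I12 v)"
  by (cases v) (auto simp: holonomy_S_def I12_def I8_A8_pow)

lemma J12_holonomy: "L \<in> holonomy_S \<Longrightarrow> J12 (L v) = L (J12 v)"
  by (cases v) (auto simp: holonomy_S_def J12_def J8_A8_pow)

lemma h12_holonomy: "L \<in> holonomy_S \<Longrightarrow> h12 (L u) (L v) = h12 u v"
  by (auto simp: holonomy_S_def h12_def h8_A8_pow)

lemma bilinear_h12: "bilinear h12"
  by (auto intro!: linearI simp: bilinear_def h12_def h8_def inner_add_left inner_add_right algebra_simps)

lemma h12_sym: "h12 u v = h12 v u"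
  by (simp add: h12_def h8_def inner_commute mult.commute)

lemma h12_I12: "h12 (I12 u) (I12 v) = h12 u v"
  by (simp add: h12_def h8_def I12_def I8_nth I4_nth inner_vec_def sum_4)

lemma h12_J12: "h12 (J12 u) (J12 v) = h12 u v"
  by (simp add: h12_def h8_def J12_def J8_nth J4_nth inner_vec_def sum_4)

text \<open>Orthogonality applied to \<open>u\<close> and \<open>I12 v\<close>, as
  \<open>I12\<close> squares to -1; this makes the fundamental form antisymmetric.\<close>

lemma h12_I12_left: "h12 (I12 u) v = - h12 u (I12 v)"
  using h12_I12[of u "I12 v"] bilinear_rneg[OF bilinear_h12, of "I12 u" v] by simp

lemma h12_J12_left: "h12 (J12 u) v = - h12 u (J12 v)"
  using h12_J12[of u "J12 v"] bilinear_rneg[OF bilinear_h12, of "J12 u" v] by simp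

lemma h12_nondegenerate:
  assumes "u \<noteq> 0"
  shows "\<exists>v. h12 u v \<noteq> 0"
proof (rule ccontr)
  assume "\<nexists>v. h12 u v \<noteq> 0"
  then have zero: "h12 u v = 0" for v by blast
  have "fst u $ i = 0" for i
    using zero[of "(axis i 1, 0)"] exhaust_8[of i] by (auto simp: h12_def h8_def axis_def)
  moreover have "snd u $ i = 0" for i
    using zero[of "(0, axis i 1)"] by (simp add: h12_def h8_def inner_axis)
  ultimately have "u = 0" by (simp add: prod_eq_iff vec_eq_iff)
  with assms show False by simp
qed

section \<open>The hypercomplex, pseudo-hyperkaehler and holomorphic symplectic structures\<close>

lemma hypercomplex_S: "hypercomplex_structure atlas_S I_S J_S K_S"
  unfolding hypercomplex_structure_def I_S_eq J_S_eq K_S_eq atlas_S_def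
proof (intro conjI S.complex_structure_const)
  show "linear (I12 \<circ> J12)" by (rule linear_compose[OF linear_J12 linear_I12])
qed (simp_all add: linear_I12 linear_J12 I12_holonomy J12_holonomy J12_I12 I12_minus J12_minus)

lemma bilinear_h12_comp:
  assumes "linear f"
  shows "bilinear (\<lambda>u v. h12 (f u) v)"
  unfolding bilinear_def
proof (intro conjI allI)
  show "linear (\<lambda>v. h12 (f u) v)" for u
    using bilinear_h12 unfolding bilinear_def by blast
  have "linear (\<lambda>z. h12 z v)" for v
    using bilinear_h12 unfolding bilinear_def by blast
  from linear_compose[OF assms this] show "linear (\<lambda>u. h12 (f u) v)" for v
    by (simp add: comp_def)
qed

lemma pseudo_hyperkaehler_S: "pseudo_hyperkaehler atlas_S I_S J_S K_S h_S"
  unfolding pseudo_hyperkaehler_def pseudo_hyperhermitian_def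
proof (intro conjI)
  show "hypercomplex_structure atlas_S I_S J_S K_S" by (rule hypercomplex_S)
  have "h12 (axis 1 1, 0) (axis 1 1, 0) > 0" "h12 (axis 2 1, 0) (axis 2 1, 0) < 0"
    by (simp_all add: h12_def h8_def axis_def)
  then show "indefinite_metric atlas_S h_S"
    using S.bilinear_field_const[OF bilinear_h12 h12_holonomy] h12_sym h12_nondegenerate
    unfolding indefinite_metric_def h_S_eq atlas_S_def by blast
  show "orthogonal_for atlas_S h_S I_S" "orthogonal_for atlas_S h_S J_S"
    "orthogonal_for atlas_S h_S K_S"
    by (simp_all add: orthogonal_for_def h_S_eq I_S_eq J_S_eq K_S_eq h12_I12 h12_J12)
  \<comment> \<open>The three fundamental forms are treated at once: skewness of \<open>f\<close>
    gives antisymmetry, commutation with the holonomy gives descent.\<close>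
  have form: "closed_two_form atlas_S (\<lambda>_ _ u v. h12 (f u) v)"
    if lin: "linear f" and skew: "\<And>u v. h12 (f u) v = - h12 u (f v)"
      and comm: "\<And>L v. L \<in> holonomy_S \<Longrightarrow> f (L v) = L (f v)" for f
    unfolding atlas_S_def
  proof (rule S.closed_two_form_const)
    show "bilinear (\<lambda>u v. h12 (f u) v)" using lin by (rule bilinear_h12_comp)
    show "h12 (f v) u = - h12 (f u) v" for u v
      using skew[of v u] h12_sym[of v "f u"] by simp
    show "h12 (f (L u)) (L v) = h12 (f u) v" if "L \<in> holonomy_S" for L u v
      using that by (simp add: comm h12_holonomy)
  qed
  have eq: "fundamental_form h_S (\<lambda>_ _. f) = (\<lambda>_ _ u v. h12 (f u) v)" for f
    by (simp add: fun_eq_iff fundamental_form_def h_S_eq)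
  show "closed_two_form atlas_S (fundamental_form h_S I_S)"
    unfolding I_S_eq eq by (intro form linear_I12 h12_I12_left I12_holonomy)
  show "closed_two_form atlas_S (fundamental_form h_S J_S)"
    unfolding J_S_eq eq by (intro form linear_J12 h12_J12_left J12_holonomy)
  show "closed_two_form atlas_S (fundamental_form h_S K_S)"
    unfolding K_S_eq eq
  proof (intro form linear_compose[OF linear_J12 linear_I12])
    show "h12 ((I12 \<circ> J12) u) v = - h12 u ((I12 \<circ> J12) v)" for u v
      by (simp add: h12_I12_left h12_J12_left J12_I12 bilinear_rneg[OF bilinear_h12])
  qed (simp add: I12_holonomy J12_holonomy)
qed

text \<open>The form is \<omega>_J + i \<omega>_K. Its type follows from JI = -K and KI = J, and its
  real part alone is already nondegenerate.\<close>

lemma holomorphic_symplectic_S: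
  "holomorphic_symplectic atlas_S I_S (\<lambda>_ _ u v. Complex (h12 (J12 u) v) (h12 (I12 (J12 u)) v))"
    (is "holomorphic_symplectic _ _ (\<lambda>_ _. ?\<Omega>)")
  unfolding holomorphic_symplectic_def
proof (intro conjI ballI allI impI)
  show "complex_structure atlas_S I_S"
    using hypercomplex_S by (simp add: hypercomplex_structure_def)
  show "closed_two_form atlas_S (\<lambda>_ _. ?\<Omega>)"
    unfolding atlas_S_def
  proof (rule S.closed_two_form_const)
    have "bilinear (\<lambda>u v. h12 (J12 u) v)" "bilinear (\<lambda>u v. h12 (I12 (J12 u)) v)"
      using bilinear_h12_comp[OF linear_J12]
        bilinear_h12_comp[OF linear_compose[OF linear_J12 linear_I12]] by (simp_all add: comp_def)
    note b = this[THEN bilinear_ladd] this[THEN bilinear_radd] this[THEN bilinear_lmul] this[THEN bilinear_rmul]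
    show "bilinear ?\<Omega>"
      unfolding bilinear_def by (intro conjI allI linearI) (simp_all add: complex_eq_iff b)
    show "?\<Omega> v u = - ?\<Omega> u v" for u v
      by (simp add: complex_eq_iff h12_I12_left h12_J12_left J12_I12 bilinear_rneg[OF bilinear_h12] h12_sym[of v])
  qed (simp add: I12_holonomy J12_holonomy h12_holonomy)
  fix u v
  show "?\<Omega> (I_S c x u) v = \<i> * ?\<Omega> u v" for c x
    by (simp add: I_S_eq complex_eq_iff J12_I12 I12_minus bilinear_lneg[OF bilinear_h12])
next
  fix u :: E12 assume u: "u \<noteq> 0"
  then have "J12 u \<noteq> 0" by (metis J12_J12 linear_0[OF linear_J12] neg_equal_0_iff_equal)
  then obtain v where "h12 (J12 u) v \<noteq> 0" using h12_nondegenerate by blast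
  then have "?\<Omega> u v \<noteq> 0" by (simp add: complex_eq_iff)
  then show "\<exists>v. ?\<Omega> u v \<noteq> 0" by blast
qed

section \<open>The Obata connection\<close>

lemma obata_S_zero: "obata_connection atlas_S I_S J_S K_S (\<lambda>_ _ _ _. 0)"
  using S.connection_zero
  by (simp add: obata_connection_def torsion_free_def preserves_def atlas_S_def I_S_eq J_S_eq K_S_eq
      linear_0[OF linear_I12] linear_0[OF linear_J12])

text \<open>A symmetric bilinear map that is \<open>I\<close>- and \<open>J\<close>-linear in both arguments satisfies
  \<open>I J \<Gamma>(u, v) = \<Gamma>(I u, J v) = J I \<Gamma>(u, v)\<close>, hence vanishes.\<close>
lemma obata_S_unique:
  assumes "obata_connection atlas_S I_S J_S K_S \<Gamma>" "c \<in> atlas_S" "x \<in> chart_image c"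
  shows "\<Gamma> c x u v = 0"
proof -
  have sym: "\<Gamma> c x u v = \<Gamma> c x v u" for u v
    using assms unfolding obata_connection_def torsion_free_def by blast
  \<comment> \<open>The structures are constant in charts, so the derivative term drops out of the
    preservation equation.\<close>
  have I: "\<Gamma> c x u (I12 v) = I12 (\<Gamma> c x u v)" and J: "\<Gamma> c x u (J12 v) = J12 (\<Gamma> c x u v)" for u v
    using assms
    by (simp_all add: obata_connection_def preserves_def I_S_eq J_S_eq del: split_paired_All)
  have "J12 (I12 (\<Gamma> c x u v)) = \<Gamma> c x (I12 u) (J12 v)"
    by (metis I J sym)
  also have "\<dots> = I12 (J12 (\<Gamma> c x u v))"
    by (metis I J sym)
  finally have "- I12 (J12 (\<Gamma> c x u v)) = I12 (J12 (\<Gamma> c x u v))"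
    by (simp add: J12_I12)
  then have "2 *\<^sub>R I12 (J12 (\<Gamma> c x u v)) = 0"
    by (metis add.left_inverse scaleR_2)
  then have "I12 (J12 (\<Gamma> c x u v)) = 0" by simp
  then have "J12 (I12 (I12 (J12 (\<Gamma> c x u v)))) = 0"
    by (simp add: linear_0[OF linear_I12] linear_0[OF linear_J12])
  then show ?thesis by (simp add: J12_minus)
qed

text \<open>The Christoffel maps vanish on the whole open chart image, so their derivatives in the
  curvature vanish as well.\<close>

lemma obata_S_flat:
  assumes "obata_connection atlas_S I_S J_S K_S \<Gamma>"
  shows "flat atlas_S \<Gamma>"
  unfolding flat_def
proof (intro ballI allI)
  fix c x u v w assume c: "c \<in> atlas_S" and x: "x \<in> chart_image c"
  have op: "open (chart_image c)" using S.open_chart_image c by (simp add: atlas_S_def)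
  have "((\<lambda>y. \<Gamma> c y a b) has_derivative (\<lambda>_. 0)) (at x)" for a b
    by (rule has_derivative_transform_within_open[OF has_derivative_const op x])
      (simp add: obata_S_unique[OF assms c])
  then have "frechet_derivative (\<lambda>y. \<Gamma> c y a b) (at x) = (\<lambda>_. 0)" for a b
    by (rule frechet_derivative_eqI)
  then show "curvature \<Gamma> c x u v w = 0"
    by (simp add: curvature_def obata_S_unique[OF assms c x])
qed

section \<open>Absence of Kaehler metrics\<close>

lemma cover_S_translate: "a \<in> lattice8 \<Longrightarrow> cover_S (z + (a, 0)) = cover_S z"
proof -
  assume "a \<in> lattice8"
  then have "cover_S z = cover_S (z + (a, 0))"
    by (cases z) (auto simp: cover_S_eq_iff intro!: exI[of _ 0])
  then show ?thesis by simp
qed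

lemma cover_S_A8: "cover_S (map_prod A8 id z + (0, axis 1 1)) = cover_S z"
proof -
  have "cover_S z = cover_S (map_prod A8 id z + (0, axis 1 1))"
    by (cases z) (auto simp: cover_S_eq_iff axis_def lattice8_0 intro!: exI[of _ 1])
  then show ?thesis by simp
qed

lemma no_kaehler_S: "\<not> kaehler_metric atlas_S I_S g"
proof
  assume kaehler: "kaehler_metric atlas_S I_S g"
  have bf: "bilinear_field (quotient_atlas cover_S) g"
    using kaehler by (simp add: kaehler_metric_def riemannian_metric_def atlas_S_def)
  define G where "G = S.lift g"
  define \<omega> where "\<omega> y u v = G y (I12 u) v" for y u v
  \<comment> \<open>Locally the pulled-back metric \<open>G\<close> is a representative of
    \<open>g\<close>, so pointwise properties and closedness transfer to the cover.\<close>
  have chart: "\<exists>U c. open U \<and> x \<in> U \<and> c \<in> atlas_S \<and> chart_image c = U \<and> (\<forall>y\<in>U. G y = g c y)" for x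
  proof -
    obtain U where U: "open U" "x \<in> U" "inj_on cover_S U" using S.locally_inj by blast
    then show ?thesis
      using S.lift_eq[OF bf U(1,3)]
      by (intro exI[of _ U] exI[of _ "(cover_S ` U, inv_into U cover_S)"])
        (auto simp: G_def atlas_S_def quotient_atlas_def fun_eq_iff)
  qed
  have G: "bilinear (G x)" "u \<noteq> 0 \<Longrightarrow> 0 < G x u u" "G x (I12 u) (I12 v) = G x u v" for x u v
  proof -
    obtain U c where U: "x \<in> U" "c \<in> atlas_S" "chart_image c = U" "G x = g c x"
      using chart[of x] by blast
    show "bilinear (G x)" "u \<noteq> 0 \<Longrightarrow> 0 < G x u u" "G x (I12 u) (I12 v) = G x u v"
      using kaehler U unfolding kaehler_metric_def riemannian_metric_def bilinear_field_def
        orthogonal_for_def I_S_eq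
      by (simp_all del: split_paired_All)
  qed
  have \<omega>_diff: "(\<lambda>y. \<omega> y a b) differentiable (at y)"
    and \<omega>_cont: "continuous_on UNIV (\<lambda>y. frechet_derivative (\<lambda>y. \<omega> y a b) (at y) c)" for a b c y
    using S.lift_C1[OF bf] by (simp_all add: \<omega>_def G_def)
  have \<omega>_closed: "frechet_derivative (\<lambda>y. \<omega> y b c) (at x) a +
      frechet_derivative (\<lambda>y. \<omega> y c a) (at x) b + frechet_derivative (\<lambda>y. \<omega> y a b) (at x) c = 0"
    for x a b c
  proof -
    obtain U d where U: "open U" "x \<in> U" "d \<in> atlas_S" "chart_image d = U" "\<And>y. y \<in> U \<Longrightarrow> G y = g d y"
      using chart[of x] by blast
    have "frechet_derivative (\<lambda>y. \<omega> y u v) (at x) =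
        frechet_derivative (\<lambda>y. fundamental_form g I_S d y u v) (at x)" for u v
      by (rule frechet_derivative_transform_within_open[OF \<omega>_diff U(1,2)])
        (simp add: \<omega>_def U(5) fundamental_form_def I_S_eq)
    moreover have "exterior_derivative (fundamental_form g I_S) d x a b c = 0"
      using kaehler U(2-4) unfolding kaehler_metric_def closed_two_form_def by blast
    ultimately show ?thesis by (simp add: exterior_derivative_def)
  qed
  have G_translate: "G (y + (a, 0)) u v = G y u v" if "a \<in> lattice8" for a y u v
    using S.lift_invariant[OF bf linear_ident, of "(a, 0)" y u v] cover_S_translate[OF that]
    by (simp add: G_def)
  have \<omega>_A8: "\<omega> (map_prod A8 id y + (0, axis 1 1)) (map_prod A8 id u) (map_prod A8 id v) = \<omega> y u v"
    for y u v
  proof -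
    have L: "map_prod A8 id \<in> holonomy_S"
      unfolding holonomy_S_def by (rule range_eqI[of _ _ 1]) (simp add: fun_eq_iff)
    show ?thesis
      using S.lift_invariant[OF bf S.linear_H[OF L] cover_S_A8] by (simp add: \<omega>_def G_def I12_holonomy[OF L])
  qed
  \<comment> \<open>The period of \<open>\<omega>\<close> over the parallelogram at \<open>x\<close>
    with sides \<open>a\<close> and \<open>I8 a\<close>; for a lattice vector \<open>a\<close> both
    sides are periods of \<open>G\<close>.\<close>
  define q where "q a x = seg_avg (a, 0) (seg_avg (I8 a, 0) (\<lambda>y. \<omega> y (a, 0) (I8 a, 0))) x" for a x
  have q_const: "q a (x + e) = q a x" if "a \<in> lattice8" for a x e
    unfolding q_def
    by (rule closed_form_period_const[OF \<omega>_diff \<omega>_cont \<omega>_closed])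
      (simp_all add: \<omega>_def G_translate that lattice8_I8)
  \<comment> \<open>The first generator carries the parallelogram of \<open>a\<close> at 0 to that
    of \<open>A8 a\<close> one unit further along the first real coordinate; \<open>I8\<close>
    commutes with \<open>A8\<close>.\<close>
  have q_A8: "q (A8 a) (0 + (0, axis 1 1)) = q a 0" for a
  proof -
    have L: "map_prod A8 id (s *\<^sub>R (a, 0) + t *\<^sub>R (I8 a, 0)) + (0, axis 1 1) =
      (0, axis 1 1) + s *\<^sub>R (A8 a, 0) + t *\<^sub>R (I8 (A8 a), 0)" for s t
      by (simp add: linear_add[OF linear_A8] linear_cmul[OF linear_A8] I8_A8)
    have "\<omega> ((0, axis 1 1) + s *\<^sub>R (A8 a, 0) + t *\<^sub>R (I8 (A8 a), 0)) (A8 a, 0) (I8 (A8 a), 0) =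
      \<omega> (s *\<^sub>R (a, 0) + t *\<^sub>R (I8 a, 0)) (a, 0) (I8 a, 0)" for s t
      using \<omega>_A8[of "s *\<^sub>R (a, 0) + t *\<^sub>R (I8 a, 0)" "(a, 0)" "(I8 a, 0)"]
      unfolding L by (simp add: I8_A8)
    then show ?thesis by (simp add: q_def seg_avg_def)
  qed
  have q_orbit: "q ((A8 ^^ k) (axis 1 1)) 0 = q (axis 1 1) 0 \<and> (A8 ^^ k) (axis 1 1) \<in> lattice8" for k
  proof (induction k)
    case 0
    show ?case by (simp add: lattice8_def axis_def)
  next
    case (Suc k)
    then show ?case
      using q_A8[of "(A8 ^^ k) (axis 1 1)"] q_const[of "(A8 ^^ Suc k) (axis 1 1)" 0 "(0, axis 1 1)"]
      by (simp add: lattice8_A8)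
  qed
  \<comment> \<open>The unit cube contains a representative of every point of the torus fibre over
    0, where \<open>q\<close> is to be estimated.\<close>
  let ?C = "cbox 0 1 \<times> {0} :: E12 set"
  have "compact ?C" by (intro compact_Times compact_cbox) simp
  moreover have "continuous_on S (\<lambda>y. G y a b)" for S a b
    using S.lift_C1(1)[OF bf]
    by (intro continuous_at_imp_continuous_on ballI differentiable_imp_continuous_within) (simp add: G_def)
  ultimately obtain c where c: "c > 0" "\<And>x u. x \<in> ?C \<Longrightarrow> c * (norm u)\<^sup>2 \<le> G x u u"
    using uniformly_positive[of ?C G] G by metis
  have G_ge: "c * (norm u)\<^sup>2 \<le> G (v, 0) u u" for v u
  proof -
    define k where "k = (\<chi> i. of_int \<lfloor>v $ i\<rfloor> :: real^8)"
    have "k \<in> lattice8" by (simp add: k_def lattice8_def)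
    then have "G (v, 0) u u = G (v - k, 0) u u"
      using G_translate[of k "(v - k, 0)"] by simp
    moreover have "(v - k, 0) \<in> ?C"
      by (auto simp: mem_box_cart k_def) linarith+
    ultimately show ?thesis using c(2) by metis
  qed
  \<comment> \<open>The integrand is \<open>G\<close> evaluated on \<open>I a\<close> twice, hence
    on \<open>a\<close> twice. Only the first coordinate of \<open>a\<close> is kept from the norm,
    since that is the one shown to grow.\<close>
  have q_ge: "c * (a $ 1)\<^sup>2 \<le> q a 0" for a
  proof -
    have cont: "continuous_on UNIV (\<lambda>y. \<omega> y (a, 0) (I8 a, 0))"
      using \<omega>_diff by (intro continuous_at_imp_continuous_on ballI differentiable_imp_continuous_within)
    have "c * (a $ 1)\<^sup>2 \<le> \<omega> (v, 0) (a, 0) (I8 a, 0)" for v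
    proof -
      have "\<omega> (v, 0) (a, 0) (I8 a, 0) = G (v, 0) (a, 0) (a, 0)"
        using G(3)[of "(v, 0)" "(a, 0)" "(a, 0)"] by (simp add: \<omega>_def I12_def I4_def)
      moreover have "(a $ 1)\<^sup>2 \<le> (norm (a, 0 :: real^4))\<^sup>2"
        using power_mono[OF component_le_norm_cart[of a 1] abs_ge_zero, of 2] by (simp add: norm_Pair)
      ultimately show ?thesis
        using G_ge[of "(a, 0)" v] c(1) by (smt (verit) mult_left_mono)
    qed
    then show ?thesis
      unfolding q_def by (intro seg_avg_ge continuous_seg_avg cont) simp
  qed
  \<comment> \<open>An orbit point with first coordinate at least \<open>n + 1\<close> has period at
    least \<open>c * (n + 1)^2\<close>, so at least \<open>c * n\<close>, exceeding the common
    period of the orbit.\<close>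
  obtain n :: nat where n: "q (axis 1 1) 0 / c < real n" using reals_Archimedean2 by blast
  obtain k a where a: "a = (A8 ^^ k) (axis 1 1)" "real (Suc n) \<le> a $ 1"
    using A8_orbit_unbounded by blast
  have "real n \<le> (real (Suc n))\<^sup>2" by (simp add: power2_eq_square algebra_simps)
  also have "\<dots> \<le> (a $ 1)\<^sup>2" using a(2) by (intro power_mono) auto
  finally have "c * real n \<le> c * (a $ 1)\<^sup>2" using c(1) by simp
  also have "\<dots> \<le> q (axis 1 1) 0" using q_ge[of a] q_orbit[of k] a(1) by simp
  finally show False using n c(1) by (simp add: field_simps)
qed

theorem theorem7p2:
  shows "det matA = 1 \<and>
    smooth_manifold S_A atlas_S \<and>
    pseudo_hyperkaehler atlas_S I_S J_S K_S h_S \<and>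
    (\<exists>J K. hypercomplex_structure atlas_S I_S J K) \<and>
    (\<exists>\<Omega>. holomorphic_symplectic atlas_S I_S \<Omega>) \<and>
    \<not> (\<exists>g. kaehler_metric atlas_S I_S g) \<and>
    (\<exists>\<Gamma>. obata_connection atlas_S I_S J_S K_S \<Gamma>) \<and>
    (\<forall>\<Gamma>. obata_connection atlas_S I_S J_S K_S \<Gamma> \<longrightarrow> flat atlas_S \<Gamma>)"
proof (intro conjI exI allI impI)
  show "smooth_manifold S_A atlas_S"
    unfolding atlas_S_def by (rule S.smooth_manifold_X)
  show "\<not> (\<exists>g. kaehler_metric atlas_S I_S g)"
    using no_kaehler_S by blast
qed (rule det_matA pseudo_hyperkaehler_S hypercomplex_S holomorphic_symplectic_S obata_S_zero
    obata_S_flat, assumption?)+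

end
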